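(* Let $p\in(0,1)$; let $T=(T_i)_{i\in\mathbb{N}}$ be independent $[0,\infty]$-valued random variables with $T_j$, $j\geq 2$, identically distributed; and let $X=(X_i)_{i\in\mathbb{N}}$ be an i.i.d. sequence of $\{0,1\}$-valued random variables, independent of $T$, with $\mathsf{P}(X_1=1)=p=1-\mathsf{P}(X_1=0)$. Let $S_n:=\sum_{i=1}^n T_i$ for $n\in\mathbb{N}$, and for $i\in\{0,1\}$ let $N^i_t:=\sum_{n\in\mathbb{N}}\mathbf{1}(S_n\leq t,\,X_n=i)$ for $t\in[0,\infty)$ and $R_i:=\inf\{t\in[0,\infty):N^i_t\geq 1\}$ (with $\inf\emptyset=\infty$). Then $R_1$ and $R_0$ are independent if and only if (precisely) one of the following conditions holds: (a) $\mathsf{P}(T_1=\infty)=1$. (b) There exists $\kappa\in[0,\infty)$ such that $\mathsf{P}(T_2=0)=\mathsf{P}(T_1=\kappa)=1$. (c) There exist $\kappa\in[0,\infty)$ and $q_0\in(0,1)$ such that $\mathcal{L}(T_1)=(1-q_0^2)\delta_\kappa+q_0^2\delta_\infty$ and $\mathcal{L}(T_2)=(1-q_0)\delta_0+q_0\delta_\infty$. (d) There exist $\kappa\in[0,\infty)$ and $\theta\in(0,\infty)$ such that $T_1-\kappa\sim\mathrm{Exp}(\theta)$ and $T_2\sim\mathrm{Exp}(\theta)$. (e) There exist $q_0\in(0,1)$, $\kappa\in[0,\infty)$ and $\alpha\in(0,\infty)$ such that $\mathcal{L}((T_1-\kappa)/\alpha)=\mathrm{geom}_{\mathbb{N}_0}(1-q_0^2)$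 and $\mathcal{L}(T_2/\alpha)=(1-q_0)\delta_0+q_0\,\mathrm{geom}_{\mathbb{N}}(1-q_0^2)$.
   Context: $\mathbb{N}=\{1,2,\dots\}$ and $\mathbb{N}_0=\mathbb{N}\cup\{0\}$. All random variables are defined on a probability space $(\Omega,\mathcal{F},\mathsf{P})$. $\mathcal{L}(V)$ denotes the law of a random element $V$; for $x_0\in[0,\infty]$, $\delta_{x_0}$ is the Dirac measure at $x_0$. For $\theta\in(0,\infty)$, $\mathrm{Exp}(\theta)$ is the exponential law with mean $\theta^{-1}$. For $r\in(0,1)$, $\mathrm{geom}_{\mathbb{N}}(r):=\sum_{k=1}^\infty r(1-r)^{k-1}\delta_k$ and $\mathrm{geom}_{\mathbb{N}_0}(r):=\sum_{k=0}^\infty r(1-r)^k\delta_k$ are the geometric laws on $\mathbb{N}$ and $\mathbb{N}_0$, respectively, with success parameter $r$. *)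

theory Defs
  imports "HOL-Probability.Probability"
begin

(* Sequences indexed by the positive integers are functions on nat of which only the
   values at indices n >= 1 are ever used. *)

definition arrival_time :: "(nat \<Rightarrow> 'a \<Rightarrow> ennreal) \<Rightarrow> nat \<Rightarrow> 'a \<Rightarrow> ennreal" where
  "arrival_time T n \<omega> = (\<Sum>i=1..n. T i \<omega>)"

(* The count may be infinite. The series runs over n >= 1, hence the shift by Suc. *)
definition arrival_count ::
  "(nat \<Rightarrow> 'a \<Rightarrow> ennreal) \<Rightarrow> (nat \<Rightarrow> 'a \<Rightarrow> nat) \<Rightarrow> nat \<Rightarrow> ennreal \<Rightarrow> 'a \<Rightarrow> ennreal" where
  "arrival_count T X i t \<omega> =
     (\<Sum>n. of_bool (arrival_time T (Suc n) \<omega> \<le> t \<and> X (Suc n) \<omega> = i))"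

(* In ennreal, Inf of the empty set is infinity. *)
definition first_arrival ::
  "(nat \<Rightarrow> 'a \<Rightarrow> ennreal) \<Rightarrow> (nat \<Rightarrow> 'a \<Rightarrow> nat) \<Rightarrow> nat \<Rightarrow> 'a \<Rightarrow> ennreal" where
  "first_arrival T X i \<omega> = Inf {t. t < \<infinity> \<and> arrival_count T X i t \<omega> \<ge> 1}"

(* The mixture (1 - q) \<mu> + q \<nu> of two measures on the same measurable space;
   see emeasure_mix below. *)
definition mix :: "real \<Rightarrow> 'b measure \<Rightarrow> 'b measure \<Rightarrow> 'b measure" where
  "mix q \<mu> \<nu> = measure_of (space \<mu>) (sets \<mu>)
     (\<lambda>A. ennreal (1 - q) * emeasure \<mu> A + ennreal q * emeasure \<nu> A)"

lemma space_mix [simp]: "space (mix q \<mu> \<nu>) = space \<mu>"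
  by (simp add: mix_def)

lemma sets_mix [simp, measurable_cong]: "sets (mix q \<mu> \<nu>) = sets \<mu>"
  by (simp add: mix_def)

lemma emeasure_mix:
  assumes "sets \<nu> = sets \<mu>" "A \<in> sets \<mu>"
  shows "emeasure (mix q \<mu> \<nu>) A = ennreal (1 - q) * emeasure \<mu> A + ennreal q * emeasure \<nu> A"
proof (rule emeasure_measure_of[OF mix_def])
  show "sets \<mu> \<subseteq> Pow (space \<mu>)"
    by (rule sets.space_closed)
  show "A \<in> sets (mix q \<mu> \<nu>)"
    using assms by simp
  show "positive (sets (mix q \<mu> \<nu>))
     (\<lambda>A. ennreal (1 - q) * emeasure \<mu> A + ennreal q * emeasure \<nu> A)"
    by (simp add: positive_def)
  show "countably_additive (sets (mix q \<mu> \<nu>))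
     (\<lambda>A. ennreal (1 - q) * emeasure \<mu> A + ennreal q * emeasure \<nu> A)"
  proof (rule countably_additiveI)
    fix B :: "nat \<Rightarrow> 'a set"
    assume B: "range B \<subseteq> sets (mix q \<mu> \<nu>)" "disjoint_family B"
    have "(\<Sum>i. ennreal (1 - q) * emeasure \<mu> (B i) + ennreal q * emeasure \<nu> (B i)) =
        ennreal (1 - q) * (\<Sum>i. emeasure \<mu> (B i)) + ennreal q * (\<Sum>i. emeasure \<nu> (B i))"
      by (subst suminf_add[symmetric]) auto
    also have "(\<Sum>i. emeasure \<mu> (B i)) = emeasure \<mu> (\<Union>i. B i)"
      using B by (intro suminf_emeasure) auto
    also have "(\<Sum>i. emeasure \<nu> (B i)) = emeasure \<nu> (\<Union>i. B i)"
      using B assms(1) by (intro suminf_emeasure) auto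
    finally show "(\<Sum>i. ennreal (1 - q) * emeasure \<mu> (B i) + ennreal q * emeasure \<nu> (B i)) =
        ennreal (1 - q) * emeasure \<mu> (\<Union>i. B i) + ennreal q * emeasure \<nu> (\<Union>i. B i)" .
  qed
qed

(* The laws below live on ereal, because T - \<kappa> may be negative or infinite (subtraction on
   ennreal would truncate at 0). *)

definition Exp_law :: "real \<Rightarrow> ereal measure" where
  "Exp_law \<theta> = distr (density lborel (\<lambda>x. ennreal (exponential_density \<theta> x))) borel ereal"

(* geometric_pmf r gives mass r (1 - r)^k to each k = 0, 1, 2, ... *)
definition geom_N0 :: "real \<Rightarrow> ereal measure" where
  "geom_N0 r = distr (measure_pmf (geometric_pmf r)) borel (\<lambda>k. ereal (real k))"

definition geom_N :: "real \<Rightarrow> ereal measure" where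
  "geom_N r = distr (measure_pmf (geometric_pmf r)) borel (\<lambda>k. ereal (real (Suc k)))"

datatype clause = Clause_a | Clause_b | Clause_c | Clause_d | Clause_e

fun clause_holds :: "'a measure \<Rightarrow> (nat \<Rightarrow> 'a \<Rightarrow> ennreal) \<Rightarrow> clause \<Rightarrow> bool" where
  "clause_holds M T Clause_a \<longleftrightarrow> measure M {\<omega> \<in> space M. T 1 \<omega> = \<infinity>} = 1"
| "clause_holds M T Clause_b \<longleftrightarrow>
     (\<exists>\<kappa>::real. \<kappa> \<ge> 0 \<and>
        measure M {\<omega> \<in> space M. T 2 \<omega> = 0} = 1 \<and>
        measure M {\<omega> \<in> space M. T 1 \<omega> = ennreal \<kappa>} = 1)"
| "clause_holds M T Clause_c \<longleftrightarrow>
     (\<exists>\<kappa> q0::real. \<kappa> \<ge> 0 \<and> 0 < q0 \<and> q0 < 1 \<and>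
        distr M borel (T 1) = mix (q0^2) (return borel (ennreal \<kappa>)) (return borel \<infinity>) \<and>
        distr M borel (T 2) = mix q0 (return borel 0) (return borel \<infinity>))"
| "clause_holds M T Clause_d \<longleftrightarrow>
     (\<exists>\<kappa> \<theta>::real. \<kappa> \<ge> 0 \<and> \<theta> > 0 \<and>
        distr M borel (\<lambda>\<omega>. enn2ereal (T 1 \<omega>) - ereal \<kappa>) = Exp_law \<theta> \<and>
        distr M borel (\<lambda>\<omega>. enn2ereal (T 2 \<omega>)) = Exp_law \<theta>)"
| "clause_holds M T Clause_e \<longleftrightarrow>
     (\<exists>q0 \<kappa> \<alpha>::real. 0 < q0 \<and> q0 < 1 \<and> \<kappa> \<ge> 0 \<and> \<alpha> > 0 \<and>
        distr M borel (\<lambda>\<omega>. (enn2ereal (T 1 \<omega>) - ereal \<kappa>) / ereal \<alpha>) = geom_N0 (1 - q0^2) \<and>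
        distr M borel (\<lambda>\<omega>. enn2ereal (T 2 \<omega>) / ereal \<alpha>) =
          mix q0 (return borel 0) (geom_N (1 - q0^2)))"

end

(* Work with Y = exp (- T), so that a law on [0, infinity] becomes a law on [0, 1], which is determined
   by its integer moments phi n = E (exp (- n T_1)), psi n = E (exp (- n T_2)), n >= 1 (similarly for
   pairs, on the unit square). One of R_1, R_0 is T_1, and the other is T_1 plus a geometric number of
   copies of T_2; summing the geometric series, p cancels and independence becomes
     phi (m + n) (1 - g m g n) = phi m phi n   with g = 1 - psi.
   Evaluating phi (a + b + c) in two ways gives g (a + b) (1 - g a g b) = g a + g b - c g a g b for some
   constant c. For c < 2 the sequence g would grow without bound; c = 2 makes g / (1 - g) additive, which
   is (d); for c = r + 1 / r > 2 the quotient (r - g) / (r (1 - r g)) is multiplicative, with base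
   z = 0 in (c) and z in (0, 1) in (e). *)

theory Submission
  imports Defs
begin

section \<open>Determination of measures by moments\<close>

text \<open>Order 0 is left out because 0 ^ 0 = 1 hides an atom at infinity, which positive orders
  see; it is supplied by the total mass. Integer orders suffice since taking one argument equal to 1
  turns the addition law into a recursion for \<open>g (Suc n)\<close>, so no regularity argument
  enters. That recursion iterates x -> (x + y - c x y) / (1 - x y) with y = \<open>g 1\<close>, and
  its fixed points solve x^2 - c x + 1 = 0 whatever y is: none is positive for c < 2, they coincide
  at 1 for c = 2, and one lies in (0, 1) for c > 2. Probability selects among the algebraic
  solutions: g < 1 excludes c < 2, and monotonicity of g excludes a negative base z. The functional
  equation fixes \<open>\<phi>\<close> in terms of \<open>\<psi>\<close> only up to a factor C ^ n,
  which is the shift by \<kappa> = - ln C; that C \<le> 1, hence \<kappa> \<ge> 0, follows from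
  monotonicity of \<open>\<phi>\<close>. The elimination of \<open>\<phi>\<close> divides by
  \<open>\<phi>\<close> and by g, so the degenerate cases \<open>\<phi> 1 = 0\<close> and
  \<open>g 1 = 0\<close> are split off beforehand; they are clauses (a) and (b).\<close>

lemma integral_abs_le_const:
  fixes f :: "'b \<Rightarrow> real"
  assumes "prob_space M" "f \<in> borel_measurable M" "AE x in M. \<bar>f x\<bar> \<le> B"
  shows "integrable M f" and "\<bar>\<integral>x. f x \<partial>M\<bar> \<le> B"
proof -
  interpret prob_space M by fact
  show int: "integrable M f"
    using assms by (intro integrable_const_bound[where B=B]) auto
  have "\<bar>\<integral>x. f x \<partial>M\<bar> \<le> (\<integral>x. \<bar>f x\<bar> \<partial>M)"
    by (rule integral_abs_bound)
  also have "\<dots> \<le> (\<integral>x. B \<partial>M)"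
    using assms int by (intro integral_mono_AE) auto
  finally show "\<bar>\<integral>x. f x \<partial>M\<bar> \<le> B"
    by (simp add: prob_space)
qed

text \<open>The indicator of a closed set is a pointwise limit of continuous functions with values
  in [0, 1]. Dominated convergence gives equality on closed sets, an intersection-stable
  generator.\<close>

lemma measure_eqI_continuous:
  fixes M N :: "'b::metric_space measure"
  assumes M: "prob_space M" "sets M = sets borel" and N: "prob_space N" "sets N = sets borel"
    and eq: "\<And>f :: 'b \<Rightarrow> real. continuous_on UNIV f \<Longrightarrow> (\<And>x. 0 \<le> f x \<and> f x \<le> 1) \<Longrightarrow>
      (\<integral>x. f x \<partial>M) = (\<integral>x. f x \<partial>N)"
  shows "M = N"
proof -
  interpret M: prob_space M by fact
  interpret N: prob_space N by fact
  note [measurable_cong] = M(2) N(2)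
  have closed_eq: "emeasure M C = emeasure N C" if C: "closed C" for C
  \<comment> \<open>By convention the distance to the empty set is 0, so the functions below would
    be constantly 1 there.\<close>
  proof (cases "C = {}")
    case False
    define f where "f k x = max 0 (1 - real k * infdist x C)" for k x
    have cont: "continuous_on UNIV (f k)" for k
      unfolding f_def by (intro continuous_intros)
    have [measurable]: "f k \<in> borel_measurable borel" for k
      using cont by (rule borel_measurable_continuous_onI)
    have bd: "0 \<le> f k x \<and> f k x \<le> 1" for k x
      by (auto simp: f_def infdist_nonneg)
    have [measurable]: "C \<in> sets borel"
      using C by simp
    have lim: "(\<lambda>k. f k x) \<longlonglongrightarrow> indicator C x" for x
    proof (cases "x \<in> C")
      case True
      then show ?thesis by (simp add: f_def)
    next
      case F: False
      then have pos: "infdist x C > 0"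
        using in_closed_iff_infdist_zero[OF C False] infdist_nonneg[of x C] by force
      obtain k0 where k0: "1 / infdist x C < real k0"
        using reals_Archimedean2 by blast
      have "f k x = 0" if "k \<ge> k0" for k
      proof -
        have "1 \<le> real k0 * infdist x C"
          using k0 pos by (simp add: field_simps)
        also have "\<dots> \<le> real k * infdist x C"
          using that by (intro mult_right_mono) (auto simp: infdist_nonneg)
        finally show ?thesis by (simp add: f_def)
      qed
      then have "eventually (\<lambda>k. f k x = indicator C x) sequentially"
        using F by (auto simp: eventually_sequentially)
      then show ?thesis by (rule tendsto_eventually)
    qed
    have conv: "(\<lambda>k. \<integral>x. f k x \<partial>L) \<longlonglongrightarrow> measure L C"
      if L: "prob_space L" "sets L = sets borel" for L
    proof -
      interpret L: prob_space L by fact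
      note [measurable_cong] = L(2)
      have "(\<lambda>k. \<integral>x. f k x \<partial>L) \<longlonglongrightarrow> (\<integral>x. indicator C x \<partial>L)"
        by (rule integral_dominated_convergence[where w="\<lambda>_. 1"]) (use lim bd in auto)
      then show ?thesis using sets_eq_imp_space_eq[OF L(2)] by simp
    qed
    have "(\<lambda>k. \<integral>x. f k x \<partial>M) = (\<lambda>k. \<integral>x. f k x \<partial>N)"
      using eq[OF cont bd] by simp
    then have "measure M C = measure N C"
      using conv[OF M] conv[OF N] by (simp add: LIMSEQ_unique)
    then show ?thesis
      by (simp add: M.emeasure_eq_measure N.emeasure_eq_measure)
  qed simp
  show ?thesis
  proof (rule measure_eqI_generator_eq[where E="Collect closed" and \<Omega>=UNIV and A="\<lambda>_. UNIV"])
    show "sets M = sigma_sets UNIV (Collect closed)" "sets N = sigma_sets UNIV (Collect closed)"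
      using M(2) N(2) by (simp_all add: borel_eq_closed)
  qed (auto simp: Int_stable_def closed_eq)
qed

text \<open>Stone-Weierstrass requires an algebra, while a set of monomials is closed under products
  only. Scalars are attached to the generators alone; with \<open>lin_span_mult\<close> and the
  constants this already yields an algebra.\<close>

inductive_set lin_span :: "('b \<Rightarrow> real) set \<Rightarrow> ('b \<Rightarrow> real) set" for G where
  scale: "g \<in> G \<Longrightarrow> (\<lambda>x. c * g x) \<in> lin_span G"
| plus: "f \<in> lin_span G \<Longrightarrow> h \<in> lin_span G \<Longrightarrow> (\<lambda>x. f x + h x) \<in> lin_span G"

lemma lin_span_mult:
  assumes G: "\<And>f h. f \<in> G \<Longrightarrow> h \<in> G \<Longrightarrow> (\<lambda>x. f x * h x) \<in> G"
    and f: "f \<in> lin_span G" and h: "h \<in> lin_span G"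
  shows "(\<lambda>x. f x * h x) \<in> lin_span G"
  using f
proof induction
  case (scale g c)
  show ?case using h
  proof induction
    case (scale g' c')
    have "(\<lambda>x. (c * c') * (g x * g' x)) \<in> lin_span G"
      by (intro lin_span.scale G) fact+
    then show ?case by (simp add: algebra_simps)
  next
    case (plus f1 h1)
    have "(\<lambda>x. (c * g x) * f1 x + (c * g x) * h1 x) \<in> lin_span G"
      by (intro lin_span.plus plus)
    then show ?case by (simp add: algebra_simps)
  qed
next
  case (plus f1 h1)
  have "(\<lambda>x. f1 x * h x + h1 x * h x) \<in> lin_span G"
    by (intro lin_span.plus plus)
  then show ?case by (simp add: algebra_simps)
qed

text \<open>By Stone-Weierstrass the span of \<open>G\<close> is uniformly dense in the continuous
  functions on the compact set \<open>K\<close> that carries both measures. \<open>K\<close> and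
  \<open>G\<close> stay abstract because the result is used on the unit interval to identify laws
  and on the unit square to identify joint laws.\<close>

lemma measure_eqI_moments:
  fixes M N :: "'b::metric_space measure" and G :: "('b \<Rightarrow> real) set"
  assumes M: "prob_space M" "sets M = sets borel" "AE x in M. x \<in> K"
    and N: "prob_space N" "sets N = sets borel" "AE x in N. x \<in> K"
    and K: "compact K"
    and G_cont: "\<And>g. g \<in> G \<Longrightarrow> continuous_on UNIV g"
    and G_one: "(\<lambda>_. 1) \<in> G"
    and G_mult: "\<And>f h. f \<in> G \<Longrightarrow> h \<in> G \<Longrightarrow> (\<lambda>x. f x * h x) \<in> G"
    and G_sep: "\<And>x y. x \<in> K \<Longrightarrow> y \<in> K \<Longrightarrow> x \<noteq> y \<Longrightarrow> \<exists>g\<in>G. g x \<noteq> g y"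
    and eq: "\<And>g. g \<in> G \<Longrightarrow> (\<integral>x. g x \<partial>M) = (\<integral>x. g x \<partial>N)"
  shows "M = N"
proof -
  interpret M: prob_space M by fact
  interpret N: prob_space N by fact
  note [measurable_cong] = M(2) N(2)
  have cont: "continuous_on UNIV f" if "f \<in> lin_span G" for f
    using that by induction (simp_all add: G_cont continuous_on_add continuous_on_mult_left)
  have int: "integrable L f"
    if L: "prob_space L" "sets L = sets borel" "AE x in L. x \<in> K" and f: "continuous_on UNIV f"
    for L and f :: "'b \<Rightarrow> real"
  proof -
    have "bounded (f ` K)"
      using K f by (intro compact_imp_bounded compact_continuous_image)
        (auto intro: continuous_on_subset)
    then obtain B where "\<And>x. x \<in> K \<Longrightarrow> \<bar>f x\<bar> \<le> B"
      unfolding bounded_iff by auto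
    moreover have "f \<in> borel_measurable L"
      using f by (simp add: borel_measurable_continuous_onI measurable_cong_sets[OF L(2) refl])
    ultimately show ?thesis
      using L by (intro integral_abs_le_const(1)[where B=B]) auto
  qed
  note int = int[OF M] int[OF N]
  have span_eq: "(\<integral>x. f x \<partial>M) = (\<integral>x. f x \<partial>N)" if "f \<in> lin_span G" for f
    using that
  proof induction
    case (plus f h)
    then show ?case using int cont by simp
  qed (simp add: eq)
  interpret function_ring_on "lin_span G" K
  proof
    show "(\<lambda>_. c) \<in> lin_span G" for c
      using lin_span.scale[OF G_one, of c] by simp
    show "\<exists>f\<in>lin_span G. f x \<noteq> f y" if "x \<in> K" "y \<in> K" "x \<noteq> y" for x y
      using G_sep[OF that] lin_span.scale[of _ G 1, simplified] by blast
    show "(\<lambda>x. f x * h x) \<in> lin_span G" if "f \<in> lin_span G" "h \<in> lin_span G" for f h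
      using lin_span_mult[OF G_mult that] by blast
  qed (auto simp: K lin_span.plus intro: continuous_on_subset[OF cont])
  show ?thesis
  proof (rule measure_eqI_continuous)
    fix f :: "'b \<Rightarrow> real" assume f: "continuous_on UNIV f"
    have [measurable]: "f \<in> borel_measurable borel"
      using f by (rule borel_measurable_continuous_onI)
    have "\<bar>(\<integral>x. f x \<partial>M) - (\<integral>x. f x \<partial>N)\<bar> \<le> e" if e: "e > 0" for e
    proof -
      obtain g where g: "g \<in> lin_span G" "\<And>x. x \<in> K \<Longrightarrow> \<bar>f x - g x\<bar> < e / 2"
        using Stone_Weierstrass_basic[OF continuous_on_subset[OF f], of "e / 2"] e by auto
      note cg = cont[OF g(1)]
      have [measurable]: "g \<in> borel_measurable borel"
        using cg by (rule borel_measurable_continuous_onI)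
      have "\<bar>\<integral>x. f x - g x \<partial>M\<bar> \<le> e / 2" "\<bar>\<integral>x. f x - g x \<partial>N\<bar> \<le> e / 2"
        by (rule integral_abs_le_const(2); use M N g(2) in \<open>force intro: less_imp_le\<close>)+
      then have "\<bar>(\<integral>x. f x \<partial>M) - (\<integral>x. g x \<partial>M)\<bar> \<le> e / 2" "\<bar>(\<integral>x. f x \<partial>N) - (\<integral>x. g x \<partial>N)\<bar> \<le> e / 2"
        by (simp_all add: int f cg)
      then show ?thesis
        using span_eq[OF g(1)] by linarith
    qed
    then show "(\<integral>x. f x \<partial>M) = (\<integral>x. f x \<partial>N)"
      by (metis abs_ge_zero abs_le_zero_iff dense_ge eq_iff_diff_eq_0)
  qed (use M N in auto)
qed

section \<open>Laplace moments of laws on \<open>[0, \<infinity>]\<close>\<close>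

text \<open>The value 0 at infinity makes this a bijection of [0, \<infinity>] onto [0, 1] that
  turns sums into products even when a summand is infinite.\<close>

definition lap :: "ennreal \<Rightarrow> real" where
  "lap x = (if x = \<infinity> then 0 else exp (- enn2real x))"

text \<open>A measurable left inverse of \<open>lap\<close>; it carries laws, independence and
  measurability back from [0, 1].\<close>

definition unlap :: "real \<Rightarrow> ennreal" where
  "unlap y = (if y = 0 then \<infinity> else ennreal (- ln y))"

lemma lap_measurable [measurable]: "lap \<in> borel_measurable borel"
  unfolding lap_def by measurable

lemma unlap_measurable [measurable]: "unlap \<in> borel_measurable borel"
  unfolding unlap_def by measurable

lemma unlap_lap [simp]: "unlap (lap x) = x"
  by (cases x) (auto simp: unlap_def lap_def)

lemma lap_nonneg [simp]: "0 \<le> lap x" and lap_le_1 [simp]: "lap x \<le> 1"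
  by (auto simp: lap_def)

lemma lap_power_le_1 [simp]: "lap x ^ n \<le> 1"
  by (intro power_le_one) auto

lemma lap_infinity [simp]: "lap \<infinity> = 0" "lap top = 0"
  by (simp_all add: lap_def)

lemma lap_ennreal: "r \<ge> 0 \<Longrightarrow> lap (ennreal r) = exp (- r)"
  by (simp add: lap_def)

lemma lap_zero [simp]: "lap 0 = 1"
  by (simp add: lap_def)

lemma lap_add: "lap (x + y) = lap x * lap y"
  by (cases x; cases y) (simp_all add: lap_ennreal mult_exp_exp flip: ennreal_plus)

lemma lap_sum: "finite A \<Longrightarrow> lap (\<Sum>i\<in>A. f i) = (\<Prod>i\<in>A. lap (f i))"
  by (induction A rule: finite_induct) (simp_all add: lap_add)

definition lap_moment :: "ennreal measure \<Rightarrow> nat \<Rightarrow> real" where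
  "lap_moment \<mu> n = (\<integral>x. lap x ^ n \<partial>\<mu>)"

lemma integrable_lap_power:
  assumes "prob_space \<mu>" "sets \<mu> = sets borel"
  shows "integrable \<mu> (\<lambda>x. lap x ^ n)"
proof -
  note [measurable_cong] = assms(2)
  show ?thesis
    by (rule integral_abs_le_const(1)[OF assms(1), where B=1]) auto
qed

text \<open>The last bound is Bernoulli's inequality integrated. It serves to conclude that all
  moments are 1 once the first one is.\<close>

lemma lap_moment_bounds:
  assumes "prob_space \<mu>" "sets \<mu> = sets borel"
  shows lap_moment_nonneg: "0 \<le> lap_moment \<mu> n"
    and lap_moment_le_1: "lap_moment \<mu> n \<le> 1"
    and lap_moment_Suc_le: "lap_moment \<mu> (Suc n) \<le> lap_moment \<mu> n"
    and lap_moment_bernoulli: "1 - lap_moment \<mu> n \<le> real n * (1 - lap_moment \<mu> 1)"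
proof -
  interpret prob_space \<mu> by fact
  note int = integrable_lap_power[OF assms]
  show "0 \<le> lap_moment \<mu> n"
    by (simp add: lap_moment_def)
  have "lap_moment \<mu> n \<le> (\<integral>x. 1 \<partial>\<mu>)"
    unfolding lap_moment_def by (intro integral_mono int) auto
  then show "lap_moment \<mu> n \<le> 1" by (simp add: prob_space)
  show "lap_moment \<mu> (Suc n) \<le> lap_moment \<mu> n"
    unfolding lap_moment_def by (intro integral_mono int power_decreasing) auto
  have "1 + real n * (y - 1) \<le> y ^ n" if "0 \<le> y" for y :: real
    using Bernoulli_inequality[of "y - 1" n] that by simp
  then have "(\<integral>x. 1 + real n * (lap x - 1) \<partial>\<mu>) \<le> lap_moment \<mu> n"
    unfolding lap_moment_def using int[of 1] by (intro integral_mono int) auto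
  also have "(\<integral>x. 1 + real n * (lap x - 1) \<partial>\<mu>) = 1 + real n * (lap_moment \<mu> 1 - 1)"
    using int[of 1] by (simp add: lap_moment_def prob_space)
  finally show "1 - lap_moment \<mu> n \<le> real n * (1 - lap_moment \<mu> 1)"
    by (simp add: algebra_simps)
qed

text \<open>Uniqueness in the Hausdorff moment problem for the image under \<open>lap\<close>,
  pulled back by \<open>unlap\<close>. The moment of order 0 is the total mass, hence 1 on both
  sides.\<close>

lemma law_eqI_lap_moment:
  assumes \<mu>: "prob_space \<mu>" "sets \<mu> = sets borel" and \<nu>: "prob_space \<nu>" "sets \<nu> = sets borel"
    and eq: "\<And>n. n \<ge> 1 \<Longrightarrow> lap_moment \<mu> n = lap_moment \<nu> n"
  shows "\<mu> = \<nu>"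
proof -
  note [measurable_cong] = \<mu>(2) \<nu>(2)
  interpret \<mu>: prob_space \<mu> by fact
  interpret \<nu>: prob_space \<nu> by fact
  have "distr \<mu> borel lap = distr \<nu> borel lap"
  proof (rule measure_eqI_moments[where K="{0..1}" and G="range (\<lambda>n x. x ^ n)"])
    show "AE x in distr \<mu> borel lap. x \<in> {0..1}" "AE x in distr \<nu> borel lap. x \<in> {0..1}"
      by (auto simp: AE_distr_iff)
    show "(\<lambda>_. 1) \<in> range (\<lambda>n (x::real). x ^ n)"
      by (rule image_eqI[of _ _ 0]) auto
    show "(\<lambda>x. f x * h x) \<in> range (\<lambda>n (x::real). x ^ n)"
      if "f \<in> range (\<lambda>n x. x ^ n)" "h \<in> range (\<lambda>n x. x ^ n)" for f h
      using that by (auto simp flip: power_add)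
    show "\<exists>g\<in>range (\<lambda>n x. x ^ n). g x \<noteq> g y" if "x \<noteq> y" for x y :: real
      using that by (auto intro!: exI[of _ 1])
    show "(\<integral>x. g x \<partial>distr \<mu> borel lap) = (\<integral>x. g x \<partial>distr \<nu> borel lap)"
      if g: "g \<in> range (\<lambda>n x. x ^ n)" for g
    proof -
      obtain n where n: "g = (\<lambda>x. x ^ n)" using g by auto
      have "measure (distr \<mu> borel lap) UNIV = 1" "measure (distr \<nu> borel lap) UNIV = 1"
        using prob_space.prob_space[OF \<mu>.prob_space_distr[of lap borel]]
          prob_space.prob_space[OF \<nu>.prob_space_distr[of lap borel]] by simp_all
      then show ?thesis
        using eq[of n] by (cases "n = 0") (auto simp: n integral_distr lap_moment_def)
    qed
  qed (auto intro: \<mu>.prob_space_distr \<nu>.prob_space_distr continuous_intros)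
  then have "distr (distr \<mu> borel lap) borel unlap = distr (distr \<nu> borel lap) borel unlap"
    by simp
  then have "distr \<mu> borel (\<lambda>x. x) = distr \<nu> borel (\<lambda>x. x)"
    by (simp add: distr_distr o_def)
  then show ?thesis
    using \<mu>(2) \<nu>(2) by (simp add: distr_id2)
qed

section \<open>Mixtures and the transforms of the explicit laws\<close>

lemma lap_moment_return [simp]: "lap_moment (return borel x) n = lap x ^ n"
  by (simp add: lap_moment_def integral_return)

lemma prob_space_mix:
  assumes "prob_space \<mu>" "prob_space \<nu>" "sets \<nu> = sets \<mu>" "0 \<le> q" "q \<le> 1"
  shows "prob_space (mix q \<mu> \<nu>)"
proof
  have "space \<nu> = space \<mu>" using assms(3) by (rule sets_eq_imp_space_eq)
  then show "emeasure (mix q \<mu> \<nu>) (space (mix q \<mu> \<nu>)) = 1"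
    using assms prob_space.emeasure_space_1[of \<mu>] prob_space.emeasure_space_1[of \<nu>]
    by (simp add: emeasure_mix flip: ennreal_plus)
qed

lemma distr_mix:
  assumes [measurable]: "f \<in> measurable \<mu> N" and \<nu>: "sets \<nu> = sets \<mu>"
  shows "distr (mix q \<mu> \<nu>) N f = mix q (distr \<mu> N f) (distr \<nu> N f)"
proof (rule measure_eqI)
  have [measurable]: "f \<in> measurable \<nu> N"
    using assms(1) by (simp add: measurable_cong_sets[OF \<nu> refl])
  have [measurable]: "f \<in> measurable (mix q \<mu> \<nu>) N"
    using assms(1) by (simp add: measurable_cong_sets[OF sets_mix refl])
  have sp: "space \<nu> = space \<mu>" using \<nu> by (rule sets_eq_imp_space_eq)
  fix A assume "A \<in> sets (distr (mix q \<mu> \<nu>) N f)"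
  then have [measurable]: "A \<in> sets N" by simp
  show "emeasure (distr (mix q \<mu> \<nu>) N f) A = emeasure (mix q (distr \<mu> N f) (distr \<nu> N f)) A"
    by (simp add: emeasure_distr emeasure_mix \<nu> sp)
qed simp

lemma nn_integral_mix:
  assumes "f \<in> borel_measurable \<mu>" and \<nu>: "sets \<nu> = sets \<mu>"
  shows "(\<integral>\<^sup>+x. f x \<partial>mix q \<mu> \<nu>) = ennreal (1 - q) * (\<integral>\<^sup>+x. f x \<partial>\<mu>) + ennreal q * (\<integral>\<^sup>+x. f x \<partial>\<nu>)"
  using assms(1)
proof (induction rule: borel_measurable_induct)
  note M = measurable_cong_sets[OF \<nu> refl, of borel] measurable_cong_sets[OF sets_mix refl, of q \<mu> \<nu> borel]
  have sp: "space \<nu> = space \<mu>" using \<nu> by (rule sets_eq_imp_space_eq)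
  {
    case (cong f g)
    then show ?case
      using sp by (simp cong: nn_integral_cong_simp)
  next
    case (set A)
    then show ?case using \<nu> by (simp add: emeasure_mix)
  next
    case (mult u c)
    then show ?case
      by (simp add: nn_integral_cmult M distrib_left mult_ac)
  next
    case (add u v)
    then show ?case
      by (simp add: nn_integral_add M distrib_left add_ac)
  next
    case (seq U)
    then have "(\<integral>\<^sup>+x. (SUP i. U i) x \<partial>mix q \<mu> \<nu>) =
        (SUP i. ennreal (1 - q) * (\<integral>\<^sup>+x. U i x \<partial>\<mu>) + ennreal q * (\<integral>\<^sup>+x. U i x \<partial>\<nu>))"
      by (simp add: SUP_apply image_comp nn_integral_monotone_convergence_SUP M)
    also have "\<dots> = (SUP i. ennreal (1 - q) * (\<integral>\<^sup>+x. U i x \<partial>\<mu>)) + (SUP i. ennreal q * (\<integral>\<^sup>+x. U i x \<partial>\<nu>))"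
      using seq by (intro ennreal_SUP_add)
        (auto simp: incseq_def le_fun_def intro!: mult_left_mono nn_integral_mono)
    finally show ?case
      using seq by (simp add: SUP_apply image_comp nn_integral_monotone_convergence_SUP M SUP_mult_left_ennreal)
  }
qed

text \<open>A mixture is given by its values on sets, so the identity is first proved for
  nonnegative integrals in \<open>ennreal\<close>; it descends to the reals because all moments are
  nonnegative.\<close>

lemma lap_moment_mix:
  assumes \<mu>: "prob_space \<mu>" "sets \<mu> = sets borel" and \<nu>: "prob_space \<nu>" "sets \<nu> = sets borel"
    and q: "0 \<le> q" "q \<le> 1"
  shows "lap_moment (mix q \<mu> \<nu>) n = (1 - q) * lap_moment \<mu> n + q * lap_moment \<nu> n"
proof -
  have sets: "sets \<nu> = sets \<mu>" "sets (mix q \<mu> \<nu>) = sets borel" using \<mu> \<nu> by simp_all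
  have *: "ennreal (lap_moment L n) = (\<integral>\<^sup>+x. lap x ^ n \<partial>L)"
    if "prob_space L" "sets L = sets borel" for L
    unfolding lap_moment_def using integrable_lap_power[OF that] by (simp add: nn_integral_eq_integral)
  have "(\<lambda>x. ennreal (lap x ^ n)) \<in> borel_measurable \<mu>"
    by (simp add: measurable_cong_sets[OF \<mu>(2) refl])
  then have "ennreal (lap_moment (mix q \<mu> \<nu>) n) =
      ennreal (1 - q) * ennreal (lap_moment \<mu> n) + ennreal q * ennreal (lap_moment \<nu> n)"
    using *[OF prob_space_mix[OF \<mu>(1) \<nu>(1) sets(1) q] sets(2)] *[OF \<mu>] *[OF \<nu>]
    by (simp add: nn_integral_mix sets)
  also have "\<dots> = ennreal ((1 - q) * lap_moment \<mu> n + q * lap_moment \<nu> n)"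
    using q lap_moment_nonneg[OF \<mu>] lap_moment_nonneg[OF \<nu>] by (simp add: ennreal_mult ennreal_plus)
  finally show ?thesis
    using q lap_moment_nonneg[OF \<mu>] lap_moment_nonneg[OF \<nu>]
      lap_moment_nonneg[OF prob_space_mix[OF \<mu>(1) \<nu>(1) sets(1) q] sets(2)]
    by (simp add: ennreal_inj del: ennreal_plus)
qed

text \<open>The counterpart of \<open>Exp_law\<close> on \<open>ennreal\<close>, where
  \<open>lap_moment\<close> is defined, with the shift \<kappa> already added.\<close>

definition shifted_exp_law :: "real \<Rightarrow> real \<Rightarrow> ennreal measure" where
  "shifted_exp_law \<kappa> \<theta> =
     distr (density lborel (\<lambda>x. ennreal (exponential_density \<theta> x))) borel (\<lambda>x. ennreal (\<kappa> + x))"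

text \<open>For \<kappa> = \<alpha> this is \<alpha> times a geometric variable on the positive
  integers, so a single transform serves both laws of clause (e).\<close>

definition affine_geom_law :: "real \<Rightarrow> real \<Rightarrow> real \<Rightarrow> ennreal measure" where
  "affine_geom_law \<kappa> \<alpha> r =
     distr (measure_pmf (geometric_pmf r)) borel (\<lambda>k. ennreal (\<kappa> + \<alpha> * real k))"

lemma sets_shifted_exp_law [simp]: "sets (shifted_exp_law \<kappa> \<theta>) = sets borel"
  and sets_affine_geom_law [simp]: "sets (affine_geom_law \<kappa> \<alpha> r) = sets borel"
  by (simp_all add: shifted_exp_law_def affine_geom_law_def)

lemma prob_space_shifted_exp_law: "\<theta> > 0 \<Longrightarrow> prob_space (shifted_exp_law \<kappa> \<theta>)"
  unfolding shifted_exp_law_def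
  by (intro prob_space.prob_space_distr prob_space_exponential_density) auto

lemma prob_space_affine_geom_law: "prob_space (affine_geom_law \<kappa> \<alpha> r)"
  unfolding affine_geom_law_def
  by (intro prob_space.prob_space_distr measure_pmf.prob_space_axioms) auto

text \<open>Exponential tilting: multiplying the density of rate \<theta> by exp (- n x) gives
  \<theta> / (\<theta> + n) times the density of rate \<theta> + n, which has mass 1.\<close>

lemma lap_moment_shifted_exp_law:
  assumes "\<kappa> \<ge> 0" "\<theta> > 0"
  shows "lap_moment (shifted_exp_law \<kappa> \<theta>) n = exp (- \<kappa>) ^ n * (\<theta> / (\<theta> + real n))"
proof -
  have pos: "\<theta> + real n > 0" using assms by (simp add: add_pos_nonneg)
  interpret D: prob_space "density lborel (\<lambda>x. ennreal (exponential_density (\<theta> + real n) x))"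
    using pos by (rule prob_space_exponential_density)
  have one: "(\<integral>x. exponential_density (\<theta> + real n) x \<partial>lborel) = 1"
    using D.emeasure_space_1 pos
    by (intro integral_eq_nn_integral[THEN trans])
      (auto simp: emeasure_density exponential_density_def)
  have "lap_moment (shifted_exp_law \<kappa> \<theta>) n =
      (\<integral>x. exponential_density \<theta> x * lap (ennreal (\<kappa> + x)) ^ n \<partial>lborel)"
    unfolding lap_moment_def shifted_exp_law_def using assms
    by (simp add: integral_distr integral_density exponential_density_def)
  also have "\<dots> = (\<integral>x. exp (- \<kappa>) ^ n * (\<theta> / (\<theta> + real n)) * exponential_density (\<theta> + real n) x \<partial>lborel)"
  proof (intro Bochner_Integration.integral_cong refl)
    fix x :: real
    show "exponential_density \<theta> x * lap (ennreal (\<kappa> + x)) ^ n =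
        exp (- \<kappa>) ^ n * (\<theta> / (\<theta> + real n)) * exponential_density (\<theta> + real n) x"
    proof (cases "x < 0")
      case False
      then show ?thesis
        using assms pos
        by (simp add: exponential_density_def lap_ennreal exp_of_nat_mult[symmetric] del: ennreal_plus)
          (simp add: field_simps flip: exp_add)
    qed (simp add: exponential_density_def)
  qed
  also have "\<dots> = exp (- \<kappa>) ^ n * (\<theta> / (\<theta> + real n))"
    using one by simp
  finally show ?thesis .
qed

lemma lap_moment_affine_geom_law:
  assumes "\<kappa> \<ge> 0" "\<alpha> \<ge> 0" "0 < r" "r < 1"
  shows "lap_moment (affine_geom_law \<kappa> \<alpha> r) n = exp (- \<kappa>) ^ n * (r / (1 - (1 - r) * exp (- \<alpha>) ^ n))"
proof -
  define a where "a = (1 - r) * exp (- \<alpha>) ^ n"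
  have "(1 - r) * exp (- \<alpha>) ^ n \<le> (1 - r) * 1"
    using assms by (intro mult_left_mono power_le_one) auto
  also have "\<dots> < 1" using assms by simp
  finally have a: "0 \<le> a" "a < 1" using assms by (auto simp: a_def)
  have sums: "(\<lambda>k. (r * exp (- \<kappa>) ^ n) * a ^ k) sums ((r * exp (- \<kappa>) ^ n) * (1 / (1 - a)))"
    using a by (intro sums_mult geometric_sums) auto
  have eq: "pmf (geometric_pmf r) k * lap (ennreal (\<kappa> + \<alpha> * real k)) ^ n = (r * exp (- \<kappa>) ^ n) * a ^ k" for k
    using assms
    by (simp add: lap_ennreal a_def power_mult_distrib exp_of_nat_mult[symmetric] del: ennreal_plus)
      (simp add: algebra_simps flip: exp_add)
  have int: "integrable (count_space UNIV) (\<lambda>k. (r * exp (- \<kappa>) ^ n) * a ^ k)"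
    using sums a assms by (simp add: integrable_count_space_nat_iff abs_mult sums_iff)
  have "lap_moment (affine_geom_law \<kappa> \<alpha> r) n =
      (\<integral>k. pmf (geometric_pmf r) k * lap (ennreal (\<kappa> + \<alpha> * real k)) ^ n \<partial>count_space UNIV)"
    unfolding lap_moment_def affine_geom_law_def measure_pmf_eq_density
    by (simp add: integral_distr integral_density)
  also have "\<dots> = (r * exp (- \<kappa>) ^ n) * (1 / (1 - a))"
    unfolding eq integral_count_space_nat[OF int] using sums by (rule sums_unique[symmetric])
  finally show ?thesis by (simp add: a_def mult_ac)
qed

section \<open>The functional equation\<close>

text \<open>Restricting to positive orders lets a moment sequence be replaced by a closed formula
  that fails at 0: with an atom at infinity as in clause (c), the moment of order 0 is 1 while the
  formula gives \<open>1 - q\<^sup>2\<close>.\<close>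

definition transform_eq :: "(nat \<Rightarrow> real) \<Rightarrow> (nat \<Rightarrow> real) \<Rightarrow> bool" where
  "transform_eq \<phi> \<psi> \<longleftrightarrow>
     (\<forall>m\<ge>1. \<forall>n\<ge>1. \<phi> (m + n) * (1 - (1 - \<psi> m) * (1 - \<psi> n)) = \<phi> m * \<phi> n)"

text \<open>Both sides of the equation acquire the factor C ^ (m + n). For C = exp (- \<kappa>) this
  is the shift of \<open>T 1\<close> by \<kappa>.\<close>

lemma transform_eq_power_scale:
  assumes "transform_eq B \<psi>" "\<And>n. n \<ge> 1 \<Longrightarrow> \<phi> n = C ^ n * B n"
  shows "transform_eq \<phi> \<psi>"
  unfolding transform_eq_def
proof (intro allI impI)
  fix m n :: nat assume mn: "1 \<le> m" "1 \<le> n"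
  then have "C ^ (m + n) * (B (m + n) * (1 - (1 - \<psi> m) * (1 - \<psi> n))) = C ^ (m + n) * (B m * B n)"
    using assms(1) by (simp add: transform_eq_def)
  then show "\<phi> (m + n) * (1 - (1 - \<psi> m) * (1 - \<psi> n)) = \<phi> m * \<phi> n"
    using mn by (simp add: assms(2) power_add mult_ac)
qed

lemma transform_eq_cong:
  assumes "\<And>n. n \<ge> 1 \<Longrightarrow> \<phi> n = \<phi>' n" "\<And>n. n \<ge> 1 \<Longrightarrow> \<psi> n = \<psi>' n"
  shows "transform_eq \<phi> \<psi> \<longleftrightarrow> transform_eq \<phi>' \<psi>'"
  unfolding transform_eq_def using assms by simp

lemma transform_eq_zero: "transform_eq (\<lambda>_. 0) \<psi>"
  by (simp add: transform_eq_def)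

lemma transform_eq_one: "transform_eq (\<lambda>_. 1) (\<lambda>_. 1)"
  by (simp add: transform_eq_def)

lemma transform_eq_const: "transform_eq (\<lambda>_. 1 - q\<^sup>2) (\<lambda>_. 1 - q)"
  by (simp add: transform_eq_def power2_eq_square)

lemma transform_eq_exponential:
  assumes "\<theta> > 0"
  shows "transform_eq (\<lambda>n. \<theta> / (\<theta> + real n)) (\<lambda>n. \<theta> / (\<theta> + real n))"
  unfolding transform_eq_def
proof (intro allI impI)
  fix m n :: nat
  have "\<theta> + real m > 0" "\<theta> + real n > 0" "\<theta> + (real m + real n) > 0"
    using assms by auto
  then show "\<theta> / (\<theta> + real (m + n)) * (1 - (1 - \<theta> / (\<theta> + real m)) * (1 - \<theta> / (\<theta> + real n))) =
      \<theta> / (\<theta> + real m) * (\<theta> / (\<theta> + real n))"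
    by (simp add: divide_simps) (simp add: algebra_simps)
qed

lemma one_minus_square_power_pos:
  fixes q z :: real
  assumes "0 < q" "q < 1" "0 \<le> z" "z \<le> 1"
  shows "1 - q\<^sup>2 * z ^ n > 0"
proof -
  have "q\<^sup>2 * z ^ n \<le> q\<^sup>2 * 1"
    using assms by (intro mult_left_mono power_le_one) auto
  also have "\<dots> < 1"
    using assms by (simp add: power_less_one_iff abs_square_less_1)
  finally show ?thesis by simp
qed

text \<open>The left side is the transform of the mixture in clause (e); the right side displays it
  as 1 - g, in the form in which g comes out of the addition law.\<close>

lemma geometric_transform_alt:
  fixes q z :: real
  assumes "0 < q" "q < 1" "0 \<le> z" "z \<le> 1"
  shows "(1 - q) + q * ((1 - q\<^sup>2) * z ^ n / (1 - q\<^sup>2 * z ^ n)) = 1 - q * (1 - z ^ n) / (1 - q\<^sup>2 * z ^ n)"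
  using one_minus_square_power_pos[OF assms, of n]
  by (simp add: divide_simps) (simp add: algebra_simps)

text \<open>The numerator of 1 - g m g n factors as
  \<open>(1 - q\<^sup>2) * (1 - q\<^sup>2 * z ^ (m + n))\<close>, and its second factor cancels the
  denominator of the transform at m + n.\<close>

lemma transform_eq_geometric:
  assumes "0 < q" "q < 1" "0 \<le> z" "z \<le> 1"
  shows "transform_eq (\<lambda>n. (1 - q\<^sup>2) / (1 - q\<^sup>2 * z ^ n))
    (\<lambda>n. (1 - q) + q * ((1 - q\<^sup>2) * z ^ n / (1 - q\<^sup>2 * z ^ n)))"
  unfolding transform_eq_def geometric_transform_alt[OF assms]
proof (intro allI impI)
  fix m n :: nat
  define a b where "a = z ^ m" and "b = z ^ n"
  have pos: "1 - q\<^sup>2 * a > 0" "1 - q\<^sup>2 * b > 0" "1 - q\<^sup>2 * (a * b) > 0"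
    using one_minus_square_power_pos[OF assms, of m] one_minus_square_power_pos[OF assms, of n]
      one_minus_square_power_pos[OF assms, of "m + n"] by (simp_all add: a_def b_def power_add)
  have "1 - (q * (1 - a) / (1 - q\<^sup>2 * a)) * (q * (1 - b) / (1 - q\<^sup>2 * b)) =
      ((1 - q\<^sup>2 * a) * (1 - q\<^sup>2 * b) - q\<^sup>2 * (1 - a) * (1 - b)) / ((1 - q\<^sup>2 * a) * (1 - q\<^sup>2 * b))"
    using pos by (simp add: divide_simps power2_eq_square) 
  also have "(1 - q\<^sup>2 * a) * (1 - q\<^sup>2 * b) - q\<^sup>2 * (1 - a) * (1 - b) = (1 - q\<^sup>2) * (1 - q\<^sup>2 * (a * b))"
    by (simp add: algebra_simps)
  finally have "(1 - q\<^sup>2) / (1 - q\<^sup>2 * (a * b)) *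
        (1 - (q * (1 - a) / (1 - q\<^sup>2 * a)) * (q * (1 - b) / (1 - q\<^sup>2 * b))) =
      (1 - q\<^sup>2) / (1 - q\<^sup>2 * a) * ((1 - q\<^sup>2) / (1 - q\<^sup>2 * b))"
    using pos by simp
  then show "(1 - q\<^sup>2) / (1 - q\<^sup>2 * z ^ (m + n)) * (1 - (1 - (1 - q * (1 - z ^ m) / (1 - q\<^sup>2 * z ^ m))) *
        (1 - (1 - q * (1 - z ^ n) / (1 - q\<^sup>2 * z ^ n)))) =
      (1 - q\<^sup>2) / (1 - q\<^sup>2 * z ^ m) * ((1 - q\<^sup>2) / (1 - q\<^sup>2 * z ^ n))"
    by (simp add: a_def b_def power_add)
qed

text \<open>For fixed \<open>\<psi>\<close> the equation with second argument 1 is a recursion in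
  which \<open>\<phi> 1\<close> is the only free value, so two positive solutions differ by the
  power of their ratio at 1. Monotonicity of \<open>\<phi>\<close> says C \<le> B n / B (n + 1), and
  the limit of these quotients gives C \<le> 1.\<close>

lemma transform_eq_unique_up_to_power:
  assumes \<phi>: "transform_eq \<phi> \<psi>" and B: "transform_eq B \<psi>"
    and pos: "\<And>n. n \<ge> 1 \<Longrightarrow> \<phi> n > 0" "\<And>n. n \<ge> 1 \<Longrightarrow> B n > 0"
    and dec: "\<And>n. n \<ge> 1 \<Longrightarrow> \<phi> (Suc n) \<le> \<phi> n"
    and lim: "(\<lambda>n. B n / B (Suc n)) \<longlonglongrightarrow> 1"
  shows "\<exists>C. 0 < C \<and> C \<le> 1 \<and> (\<forall>n\<ge>1. \<phi> n = C ^ n * B n)"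
proof -
  define C where "C = \<phi> 1 / B 1"
  have C: "0 < C" using pos by (simp add: C_def)
  have eq: "\<phi> n = C ^ n * B n" if "n \<ge> 1" for n
    using that
  proof (induction n rule: dec_induct)
    case base
    then show ?case using pos(2)[of 1] by (simp add: C_def)
  next
    case (step n)
    define k where "k = 1 - (1 - \<psi> n) * (1 - \<psi> 1)"
    have 1: "\<phi> (Suc n) * k = \<phi> n * \<phi> 1" "B (Suc n) * k = B n * B 1"
      using \<phi> B step(1) unfolding transform_eq_def k_def
      by (metis Suc_eq_plus1 order_refl)+
    have "k \<noteq> 0"
      using 1(2) pos(2)[of n] pos(2)[of 1] step(1) by auto
    moreover have "\<phi> (Suc n) * k = C ^ Suc n * B (Suc n) * k"
    proof -
      have "\<phi> 1 = C * B 1" using pos(2)[of 1] by (simp add: C_def)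
      then have "\<phi> (Suc n) * k = C ^ Suc n * (B n * B 1)"
        using 1(1) step.IH by (simp add: mult_ac)
      then show ?thesis using 1(2) by (simp add: mult_ac)
    qed
    ultimately show ?case by simp
  qed
  have "C \<le> B n / B (Suc n)" if n: "n \<ge> 1" for n
  proof -
    have "C ^ n * (C * B (Suc n)) \<le> C ^ n * B n"
      using dec[OF n] eq[OF n] eq[of "Suc n"] by (simp add: mult_ac)
    then have "C * B (Suc n) \<le> B n"
      using C by simp
    then show ?thesis
      using pos(2)[of "Suc n"] by (simp add: field_simps)
  qed
  then have "C \<le> 1"
    using lim by (intro LIMSEQ_le_const) auto
  then show ?thesis using C eq by blast
qed

lemma power_of_multiplicative_step:
  fixes H :: "nat \<Rightarrow> real"
  assumes "\<And>n. n \<ge> 1 \<Longrightarrow> H (Suc n) = H n * H 1" "n \<ge> 1"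
  shows "H n = H 1 ^ n"
  using assms(2) by (induction n rule: dec_induct) (simp_all add: assms(1) mult.commute)

text \<open>Evaluating \<open>\<phi> (a + b + c)\<close> in two ways eliminates \<open>\<phi>\<close>; what remains for \<open>g\<close> is an addition law
  whose only free parameter is \<open>c\<close>. The case distinction below is on the fixed points
  \<open>r, 1 / r\<close> (\<open>r + 1 / r = c\<close>) of the Moebius map \<open>x \<mapsto> (x + y - c x y) / (1 - x y)\<close>.\<close>

lemma addition_law:
  fixes g :: "nat \<Rightarrow> real"
  assumes \<phi>: "transform_eq \<phi> (\<lambda>n. 1 - g n)"
    and pos: "\<And>n. n \<ge> 1 \<Longrightarrow> \<phi> n > 0" "\<And>n. n \<ge> 1 \<Longrightarrow> g n > 0"
  shows "\<exists>c. \<forall>a\<ge>1. \<forall>b\<ge>1. g (a + b) * (1 - g a * g b) = g a + g b - c * g a * g b"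
proof -
  have FE: "\<phi> (m + n) * (1 - g m * g n) = \<phi> m * \<phi> n" if "m \<ge> 1" "n \<ge> 1" for m n
    using \<phi> that by (simp add: transform_eq_def)
  \<comment> \<open>Both bracketings of \<open>\<phi> (a + b + c)\<close> equal
    \<open>\<phi> a * \<phi> b * \<phi> c\<close> after clearing factors, and the positive
    \<open>\<phi> (a + b + c)\<close> cancels.\<close>
  have assoc: "(1 - g (a + b) * g c) * (1 - g a * g b) = (1 - g a * g (b + c)) * (1 - g b * g c)"
    if "a \<ge> 1" "b \<ge> 1" "c \<ge> 1" for a b c
  proof -
    have "\<phi> (a + b + c) * ((1 - g (a + b) * g c) * (1 - g a * g b)) =
        \<phi> (a + b) * (1 - g a * g b) * \<phi> c"
      using FE[of "a + b" c] that by (simp add: mult.assoc[symmetric])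
    also have "\<dots> = \<phi> a * (\<phi> (b + c) * (1 - g b * g c))"
      using FE[of a b] FE[of b c] that by (simp add: mult_ac)
    also have "\<dots> = \<phi> (a + b + c) * ((1 - g a * g (b + c)) * (1 - g b * g c))"
      using FE[of a "b + c"] that by (simp add: mult.assoc[symmetric] add_ac)
    finally show ?thesis using pos(1)[of "a + b + c"] that by simp
  qed
  \<comment> \<open>Solving \<open>assoc\<close> with third argument 1 for
    \<open>g (a + b) * (1 - g a * g b)\<close> gives an expression affine in \<open>g a\<close>,
    with constant term \<open>g b\<close> and this slope, which depends on b alone.\<close>
  define K where "K b = (g (b + 1) * (1 - g b * g 1) - g b) / g 1" for b
  have 1: "g (a + b) * (1 - g a * g b) = g b + K b * g a" if "a \<ge> 1" "b \<ge> 1" for a b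
  proof -
    have "K b * g 1 = g (b + 1) * (1 - g b * g 1) - g b"
      using pos(2)[of 1] by (simp add: K_def)
    moreover have "(g b + K b * g a) * g 1 = g b * g 1 + (K b * g 1) * g a"
      by (simp add: algebra_simps)
    ultimately have "(g b + K b * g a) * g 1 = g b * g 1 + (g (b + 1) * (1 - g b * g 1) - g b) * g a"
      by simp
    also have "\<dots> = (g (a + b) * (1 - g a * g b)) * g 1"
      using assoc[OF that, of 1] by (simp add: algebra_simps)
    finally show ?thesis using pos(2)[of 1] by simp
  qed
  \<comment> \<open>The left side of \<open>1\<close> is symmetric in a and b. Comparing the two
    right sides with one argument equal to 1 forces K to be affine in g, with slope - c.\<close>
  define c where "c = (1 - K 1) / g 1"
  have c: "K b = 1 - c * g b" if "b \<ge> 1" for b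
  proof -
    have sym: "g b + K b * g 1 = g 1 + K 1 * g b"
      using 1[of 1 b] 1[of b 1] that by (simp add: add_ac mult_ac)
    have "(1 - c * g b) * g 1 = g 1 - g b * (c * g 1)"
      by (simp add: algebra_simps)
    also have "c * g 1 = 1 - K 1"
      using pos(2)[of 1] by (simp add: c_def)
    also have "g 1 - g b * (1 - K 1) = K b * g 1"
      using sym by (simp add: algebra_simps)
    finally have "K b * g 1 = (1 - c * g b) * g 1" ..
    then show ?thesis using pos(2)[of 1] by simp
  qed
  have "g (a + b) * (1 - g a * g b) = g a + g b - c * g a * g b" if "a \<ge> 1" "b \<ge> 1" for a b
    using 1[OF that] c[OF that(2)] by (simp add: algebra_simps)
  then show ?thesis by blast
qed

lemma addition_law_solutions:
  fixes g :: "nat \<Rightarrow> real"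
  assumes add: "\<And>n. n \<ge> 1 \<Longrightarrow> g (Suc n) * (1 - g n * g 1) = g n + g 1 - c * g n * g 1"
    and pos: "\<And>n. n \<ge> 1 \<Longrightarrow> 0 < g n" and lt: "\<And>n. n \<ge> 1 \<Longrightarrow> g n < 1"
    and inc: "\<And>n. n \<ge> 1 \<Longrightarrow> g n \<le> g (Suc n)"
  shows "(\<exists>\<theta>>0. \<forall>n\<ge>1. g n = 1 - \<theta> / (\<theta> + real n)) \<or>
    (\<exists>q z. 0 < q \<and> q < 1 \<and> 0 \<le> z \<and> z < 1 \<and> (\<forall>n\<ge>1. g n = q * (1 - z ^ n) / (1 - q\<^sup>2 * z ^ n)))"
proof -
  have g1: "0 < g 1" "g 1 < 1" using pos lt by auto
  have prod: "0 < 1 - g n * g 1" "1 - g n * g 1 < 1" if "n \<ge> 1" for n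
  proof -
    have "g n * g 1 < 1 * 1"
      using that g1 pos lt by (intro mult_strict_mono) (auto intro: less_imp_le)
    then show "0 < 1 - g n * g 1" "1 - g n * g 1 < 1"
      using pos[OF that] g1 by auto
  qed
  have "c \<ge> 2"
  proof (rule ccontr)
    assume "\<not> c \<ge> 2"
    then have c: "c < 2" by simp
    \<comment> \<open>With x = \<open>g n\<close> and y = \<open>g 1\<close>, the recursion gives (g
      (n + 1) - x) (1 - x y) = y ((1 - x)^2 + (2 - c) x). As x \<ge> y, every increment of g is at
      least this constant.\<close>
    define \<delta> where "\<delta> = (2 - c) * (g 1)\<^sup>2"
    have \<delta>: "\<delta> > 0" using c g1 by (simp add: \<delta>_def)
    have step: "g (Suc n) \<ge> g n + \<delta>" if n: "n \<ge> 1" for n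
    proof -
      have g1n: "g 1 \<le> g n"
        using n by (induction n rule: dec_induct) (use inc in \<open>auto intro: order_trans\<close>)
      have "(g (Suc n) - g n) * (1 - g n * g 1) = g 1 * ((1 - g n)\<^sup>2 + (2 - c) * g n)"
        using add[OF n] by (simp add: algebra_simps power2_eq_square)
      also have "\<dots> \<ge> g 1 * ((2 - c) * g 1)"
        using g1 c g1n by (intro mult_left_mono) (auto intro: add_increasing mult_left_mono)
      finally have "\<delta> \<le> (g (Suc n) - g n) * (1 - g n * g 1)"
        by (simp add: \<delta>_def power2_eq_square mult_ac)
      also have "\<dots> \<le> (g (Suc n) - g n) * 1"
        using inc[OF n] prod[OF n] by (intro mult_left_mono) auto
      finally show ?thesis by simp
    qed
    have lin: "g (Suc n) \<ge> real n * \<delta>" for n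
    proof (induction n)
      case 0
      then show ?case using g1 by simp
    next
      case (Suc n)
      then show ?case using step[of "Suc n"] by (simp add: algebra_simps)
    qed
    obtain n where "1 / \<delta> < real n"
      using reals_Archimedean2 by blast
    then have "1 < real n * \<delta>" using \<delta> by (simp add: field_simps)
    then show False using lin[of n] lt[of "Suc n"] by simp
  qed
  then consider "c = 2" | "c > 2" by linarith
  then show ?thesis
  proof cases
    case 1
    \<comment> \<open>The double fixed point 1 is sent to infinity, so the recursion becomes
      translation by \<open>u 1\<close>. Solving n \<open>u 1\<close> = g / (1 - g) for g yields
      \<theta> = 1 / \<open>u 1\<close>.\<close>
    define u where "u n = g n / (1 - g n)" for n
    have u1: "u 1 > 0" using g1 by (simp add: u_def)
    have u: "u n = real n * u 1" if "n \<ge> 1" for n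
      using that
    proof (induction n rule: dec_induct)
      case (step n)
      have *: "g (Suc n) = (g n + g 1 - 2 * g n * g 1) / (1 - g n * g 1)"
        using add[of n] prod[of n] step(1) 1 by (simp add: field_simps)
      have **: "1 - g (Suc n) = (1 - g n) * (1 - g 1) / (1 - g n * g 1)"
        unfolding * using prod[of n] step(1) by (simp add: field_simps)
      have "u (Suc n) = (g n + g 1 - 2 * g n * g 1) / ((1 - g n) * (1 - g 1))"
        unfolding u_def ** unfolding * using prod[of n] step(1) by simp
      also have "\<dots> = u n + u 1"
        using lt[of n] lt[of 1] step(1) by (simp add: u_def divide_simps) (simp add: algebra_simps)
      finally show ?case using step.IH by (simp add: algebra_simps)
    qed simp
    have "g n = 1 - (1 / u 1) / (1 / u 1 + real n)" if n: "n \<ge> 1" for n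
    proof -
      have "g n = u n / (1 + u n)"
        using lt[OF n] by (simp add: u_def field_simps)
      moreover have "1 + real n * u 1 > 0"
        using u1 by (simp add: add_pos_nonneg)
      ultimately show ?thesis
        using u1 u[OF n] by (simp add: field_simps)
    qed
    then show ?thesis using u1 by (intro disjI1 exI[of _ "1 / u 1"]) auto
  next
    case 2
    \<comment> \<open>The smaller root of x^2 - c x + 1; the other root is 1 / r, so r lies in (0,
      1).\<close>
    define r where "r = (c - sqrt (c\<^sup>2 - 4)) / 2"
    have c4: "c\<^sup>2 > 4" using 2 power_strict_mono[of 2 c 2] by simp
    have s2: "(sqrt (c\<^sup>2 - 4))\<^sup>2 = c\<^sup>2 - 4" using c4 by simp
    have rc: "c * r = 1 + r\<^sup>2"
      unfolding r_def power_divide power2_diff s2 by (simp add: field_simps power2_eq_square)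
    have "sqrt (c\<^sup>2 - 4) < sqrt (c\<^sup>2)" by (intro real_sqrt_less_mono) simp
    then have r0: "r > 0" using 2 by (simp add: r_def)
    have "(c - 2)\<^sup>2 < c\<^sup>2 - 4"
      using 2 by (simp add: power2_eq_square algebra_simps)
    then have "sqrt ((c - 2)\<^sup>2) < sqrt (c\<^sup>2 - 4)" by (rule real_sqrt_less_mono)
    then have r1: "r < 1" using 2 by (simp add: r_def)
    have rg: "1 - r * g n > 0" if "n \<ge> 1" for n
      using mult_strict_mono[of r 1 "g n" 1] r1 r0 pos[OF that] lt[OF that] by simp
    \<comment> \<open>This sends the fixed points r and 1 / r to 0 and infinity, which makes the
      recursion a multiplication. The factor r in the denominator normalizes the value at g = 0 to
      1.\<close>
    define H where "H n = (r - g n) / (r * (1 - r * g n))" for n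
    have H_step: "H (Suc n) = H n * H 1" if n: "n \<ge> 1" for n
    proof -
      define x y where "x = g n" and "y = g 1"
      have *: "g (Suc n) = (x + y - c * x * y) / (1 - x * y)"
        using add[OF n] prod[OF n] by (simp add: field_simps x_def y_def)
      have P: "1 - x * y > 0" "1 - r * x > 0" "1 - r * y > 0"
        using prod[OF n] rg[OF n] rg[of 1] by (auto simp: x_def y_def)
      have e1: "r * (r - g (Suc n)) = (r - x) * (r - y) / (1 - x * y)"
      proof -
        have "r * (r - g (Suc n)) = (r\<^sup>2 * (1 - x * y) - (r * x + r * y - (c * r) * x * y)) / (1 - x * y)"
          unfolding * using P(1) by (simp add: divide_simps) (simp add: algebra_simps power2_eq_square)
        then show ?thesis unfolding rc by (simp add: algebra_simps power2_eq_square)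
      qed
      have e2: "1 - r * g (Suc n) = (1 - r * x) * (1 - r * y) / (1 - x * y)"
      proof -
        have "1 - r * g (Suc n) = (1 - x * y - (r * x + r * y - (c * r) * x * y)) / (1 - x * y)"
          unfolding * using P(1) by (simp add: divide_simps) (simp add: algebra_simps power2_eq_square)
        then show ?thesis unfolding rc by (simp add: algebra_simps power2_eq_square)
      qed
      have "H (Suc n) = (r * (r - g (Suc n))) / (r\<^sup>2 * (1 - r * g (Suc n)))"
        using r0 by (simp add: H_def power2_eq_square)
      also have "\<dots> = ((r - x) * (r - y)) / (r\<^sup>2 * ((1 - r * x) * (1 - r * y)))"
        unfolding e1 e2 using P by simp
      also have "\<dots> = H n * H 1"
        by (simp add: H_def x_def y_def power2_eq_square mult_ac)
      finally show ?thesis .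
    qed
    \<comment> \<open>The increment from \<open>g 1\<close> to \<open>g 2\<close> has the sign of
      x^2 - c x + 1 at x = \<open>g 1\<close>. This is negative between r and 1 / r, and
      \<open>g 1\<close> < 1 < 1 / r.\<close>
    have "g 1 \<le> r"
    proof (rule ccontr)
      assume "\<not> g 1 \<le> r"
      then have gr: "g 1 > r" by simp
      have "(g 2 - g 1) * (1 - g 1 * g 1) = g 1 * (1 - c * g 1 + g 1 * g 1)"
        using add[of 1] by (simp add: algebra_simps numeral_2_eq_2)
      moreover have "(g 2 - g 1) * (1 - g 1 * g 1) \<ge> 0"
        using inc[of 1] prod[of 1] by (simp add: numeral_2_eq_2)
      ultimately have "1 - c * g 1 + g 1 * g 1 \<ge> 0"
        using g1 by (simp add: zero_le_mult_iff)
      then have "r * (1 - c * g 1 + g 1 * g 1) \<ge> 0"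
        using r0 by simp
      also have "r * (1 - c * g 1 + g 1 * g 1) = r - (c * r) * g 1 + r * g 1 * g 1"
        by (simp add: algebra_simps)
      also have "\<dots> = (g 1 - r) * (r * g 1 - 1)"
        unfolding rc by (simp add: algebra_simps power2_eq_square)
      finally show False
        using gr rg[of 1] by (simp add: zero_le_mult_iff)
    qed
    then have H0: "H 1 \<ge> 0" using r0 rg[of 1] by (simp add: H_def)
    \<comment> \<open>Thus the numerator r - \<open>g 1\<close> of \<open>H 1\<close> is below its
      denominator r - r^2 \<open>g 1\<close>.\<close>
    have "r * (r * g 1) < 1 * g 1"
      unfolding mult.assoc[symmetric]
      using r0 r1 g1 mult_strict_mono[of r 1 r 1] by (intro mult_strict_right_mono) auto
    then have H1: "H 1 < 1"
      using r0 rg[of 1] by (simp add: H_def divide_simps) (simp add: algebra_simps)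
    have "g n = r * (1 - H 1 ^ n) / (1 - r\<^sup>2 * H 1 ^ n)" if n: "n \<ge> 1" for n
    proof -
      have "H 1 ^ n = H n" using power_of_multiplicative_step[OF H_step n] by simp
      moreover have "H n * (r * (1 - r * g n)) = r - g n"
        using rg[OF n] r0 by (simp add: H_def)
      then have "g n * (1 - r\<^sup>2 * H n) = r * (1 - H n)"
        by (simp add: algebra_simps power2_eq_square)
      ultimately show ?thesis
        using one_minus_square_power_pos[OF r0 r1 H0 less_imp_le[OF H1], of n]
        by (simp add: field_simps)
    qed
    then show ?thesis using r0 r1 H0 H1 by blast
  qed
qed

text \<open>The four alternatives correspond to the clauses (b)--(e), with \<open>C = exp (- \<kappa>)\<close> and
  \<open>z = exp (- \<alpha>)\<close>.\<close>

lemma transform_eq_solutions: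
  fixes \<phi> \<psi> :: "nat \<Rightarrow> real"
  assumes eq: "transform_eq \<phi> \<psi>"
    and \<phi>: "\<phi> 1 \<noteq> 0" "\<And>n. \<phi> n \<ge> 0" "\<And>n. \<phi> (Suc n) \<le> \<phi> n"
    and \<psi>: "\<And>n. \<psi> n \<ge> 0" "\<And>n. \<psi> n \<le> 1" "\<And>n. \<psi> (Suc n) \<le> \<psi> n"
      "\<And>n. 1 - \<psi> n \<le> real n * (1 - \<psi> 1)"
  obtains
    (deterministic) C where "0 < C" "C \<le> 1" "\<And>n. n \<ge> 1 \<Longrightarrow> \<phi> n = C ^ n" "\<And>n. n \<ge> 1 \<Longrightarrow> \<psi> n = 1"
  | (two_point) C q where "0 < C" "C \<le> 1" "0 < q" "q < 1"
      "\<And>n. n \<ge> 1 \<Longrightarrow> \<phi> n = C ^ n * (1 - q\<^sup>2)" "\<And>n. n \<ge> 1 \<Longrightarrow> \<psi> n = 1 - q"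
  | (exponential) C \<theta> where "0 < C" "C \<le> 1" "0 < \<theta>"
      "\<And>n. n \<ge> 1 \<Longrightarrow> \<phi> n = C ^ n * (\<theta> / (\<theta> + real n))" "\<And>n. n \<ge> 1 \<Longrightarrow> \<psi> n = \<theta> / (\<theta> + real n)"
  | (geometric) C q z where "0 < C" "C \<le> 1" "0 < q" "q < 1" "0 < z" "z < 1"
      "\<And>n. n \<ge> 1 \<Longrightarrow> \<phi> n = C ^ n * ((1 - q\<^sup>2) / (1 - q\<^sup>2 * z ^ n))"
      "\<And>n. n \<ge> 1 \<Longrightarrow> \<psi> n = (1 - q) + q * ((1 - q\<^sup>2) * z ^ n / (1 - q\<^sup>2 * z ^ n))"
proof -
  define g where "g n = 1 - \<psi> n" for n
  have g: "0 \<le> g n" "g n \<le> 1" "g n \<le> g (Suc n)" for n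
    using \<psi>(1-3)[of n] by (auto simp: g_def)
  have FE: "\<phi> (m + n) * (1 - g m * g n) = \<phi> m * \<phi> n" if "m \<ge> 1" "n \<ge> 1" for m n
    using eq that by (simp add: transform_eq_def g_def)
  have \<phi>_pos: "\<phi> n > 0" if "n \<ge> 1" for n
  proof -
    have "\<phi> n \<noteq> 0"
      using that
    proof (induction n rule: dec_induct)
      case (step n)
      then show ?case using FE[of n 1] \<phi>(1) by auto
    qed (use \<phi> in auto)
    then show ?thesis using \<phi>(2)[of n] by simp
  qed
  \<comment> \<open>What remains in each case is to recognize \<open>\<psi>\<close>: one positive
    solution B of the equation with this \<open>\<psi>\<close>, with quotients tending to 1, then
    determines \<open>\<phi>\<close>.\<close>
  have B_eq: "\<exists>C. 0 < C \<and> C \<le> 1 \<and> (\<forall>n\<ge>1. \<phi> n = C ^ n * B n)"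
    if "transform_eq B \<psi>'" "\<And>n. n \<ge> 1 \<Longrightarrow> \<psi> n = \<psi>' n" "\<And>n. n \<ge> 1 \<Longrightarrow> B n > 0"
      "(\<lambda>n. B n / B (Suc n)) \<longlonglongrightarrow> 1" for B \<psi>'
    using that transform_eq_cong[of B B \<psi> \<psi>']
    by (intro transform_eq_unique_up_to_power[OF eq]) (auto intro: \<phi>_pos \<phi>(3))
  show thesis
  proof (cases "g 1 = 0")
    case True
    then have "\<psi> n = 1" for n
      using \<psi>(4)[of n] \<psi>(2)[of n] by (simp add: g_def)
    then show thesis
      using B_eq[OF transform_eq_one] deterministic by auto
  next
    case False
    have g_pos: "g n > 0" if "n \<ge> 1" for n
      using that
    proof (induction n rule: dec_induct)
      case base
      then show ?case using False g(1)[of 1] by simp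
    next
      case (step n)
      then show ?case using g(3)[of n] by simp
    qed
    \<comment> \<open>The value 1 is excluded because the left side of the equation at (n, n) would
      vanish while the right side is a positive square.\<close>
    have g_lt: "g n < 1" if "n \<ge> 1" for n
    proof -
      have "\<phi> (n + n) * (1 - g n * g n) > 0"
        using FE[OF that that] \<phi>_pos[OF that] by simp
      then have "g n * g n < 1"
        using \<phi>_pos[of "n + n"] that by (simp add: zero_less_mult_iff)
      then show ?thesis using g(2)[of n] by (cases "g n = 1") auto
    qed
    have "transform_eq \<phi> (\<lambda>n. 1 - g n)" using eq by (simp add: g_def)
    from addition_law[OF this \<phi>_pos g_pos] obtain c
      where c: "\<And>a b. a \<ge> 1 \<Longrightarrow> b \<ge> 1 \<Longrightarrow> g (a + b) * (1 - g a * g b) = g a + g b - c * g a * g b"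
      by blast
    have "g (Suc n) * (1 - g n * g 1) = g n + g 1 - c * g n * g 1" if "n \<ge> 1" for n
      using c[of n 1] that by simp
    with g_pos g_lt g(3)
    have "(\<exists>\<theta>>0. \<forall>n\<ge>1. g n = 1 - \<theta> / (\<theta> + real n)) \<or>
      (\<exists>q z. 0 < q \<and> q < 1 \<and> 0 \<le> z \<and> z < 1 \<and> (\<forall>n\<ge>1. g n = q * (1 - z ^ n) / (1 - q\<^sup>2 * z ^ n)))"
      by (intro addition_law_solutions[of g c]) auto
    then show thesis
    proof (elim disjE exE conjE)
      fix \<theta> :: real assume \<theta>: "\<theta> > 0" "\<forall>n\<ge>1. g n = 1 - \<theta> / (\<theta> + real n)"
      then have \<psi>': "\<psi> n = \<theta> / (\<theta> + real n)" if "n \<ge> 1" for n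
        using that by (simp add: g_def)
      have "(\<lambda>n. \<theta> / (\<theta> + real n) / (\<theta> / (\<theta> + real (Suc n)))) \<longlonglongrightarrow> 1"
      proof (rule Lim_transform_eventually)
        have "filterlim (\<lambda>n. real n + \<theta>) at_top sequentially"
          using \<theta>(1) by (intro filterlim_at_top_mono[OF filterlim_real_sequentially]) auto
        then have "(\<lambda>n. 1 + 1 / (real n + \<theta>)) \<longlonglongrightarrow> 1 + 0"
          by (intro tendsto_add tendsto_const tendsto_divide_0[OF tendsto_const]
              filterlim_at_top_imp_at_infinity)
        then show "(\<lambda>n. 1 + 1 / (real n + \<theta>)) \<longlonglongrightarrow> 1" by simp
        show "\<forall>\<^sub>F n in sequentially. 1 + 1 / (real n + \<theta>) =
            \<theta> / (\<theta> + real n) / (\<theta> / (\<theta> + real (Suc n)))"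
          using \<theta>(1) by (auto intro!: always_eventually simp: field_simps add_nonneg_eq_0_iff)
      qed
      then show thesis
        using B_eq[OF transform_eq_exponential[OF \<theta>(1)] \<psi>'] \<theta>(1) \<psi>' exponential
        by (auto simp: add_pos_nonneg)
    next
      fix q z :: real assume q: "0 < q" "q < 1" and z: "0 \<le> z" "z < 1"
        and gz: "\<forall>n\<ge>1. g n = q * (1 - z ^ n) / (1 - q\<^sup>2 * z ^ n)"
      have \<psi>': "\<psi> n = (1 - q) + q * ((1 - q\<^sup>2) * z ^ n / (1 - q\<^sup>2 * z ^ n))" if "n \<ge> 1" for n
      proof -
        have "\<psi> n = 1 - g n" by (simp add: g_def)
        then show ?thesis
          unfolding geometric_transform_alt[OF q z(1) less_imp_le[OF z(2)], of n]
          using gz that by simp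
      qed
      have q2: "1 - q\<^sup>2 > 0" using q by (simp add: abs_square_less_1)
      note P = one_minus_square_power_pos[OF q z(1) less_imp_le[OF z(2)]]
      have "(\<lambda>n. (1 - q\<^sup>2) / (1 - q\<^sup>2 * z ^ n) / ((1 - q\<^sup>2) / (1 - q\<^sup>2 * z ^ Suc n))) \<longlonglongrightarrow>
          (1 - q\<^sup>2) / (1 - q\<^sup>2 * 0) / ((1 - q\<^sup>2) / (1 - q\<^sup>2 * 0))"
        using z q2 by (intro tendsto_intros LIMSEQ_Suc LIMSEQ_realpow_zero) auto
      then have "\<exists>C. 0 < C \<and> C \<le> 1 \<and> (\<forall>n\<ge>1. \<phi> n = C ^ n * ((1 - q\<^sup>2) / (1 - q\<^sup>2 * z ^ n)))"
        using P q2 z q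
        by (intro B_eq[OF transform_eq_geometric[OF q z(1) less_imp_le[OF z(2)]] \<psi>']) auto
      then obtain C where C: "0 < C" "C \<le> 1" "\<And>n. n \<ge> 1 \<Longrightarrow> \<phi> n = C ^ n * ((1 - q\<^sup>2) / (1 - q\<^sup>2 * z ^ n))"
        by blast
      show thesis
      \<comment> \<open>For z = 0 the lattice step \<alpha> = - ln z is infinite: the geometric part
        of both laws degenerates to an atom at infinity, which is clause (c).\<close>
      proof (cases "z = 0")
        case True
        then show thesis using two_point[OF C(1,2) q] C(3) \<psi>' by (simp add: power_0_left)
      next
        case False
        then show thesis using geometric[OF C(1,2) q _ z(2) C(3) \<psi>'] z(1) by simp
      qed
    qed
  qed
qed

section \<open>The clauses in terms of Laplace moments\<close>

text \<open>The clauses live on \<open>ereal\<close>, the moments on \<open>ennreal\<close>. On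
  [0, \<infinity>] the map t -> (t - \<kappa>) / \<alpha> is undone by y -> \<alpha> y + \<kappa>.
  Since \<open>e2ennreal\<close> truncates negative values, the inverse relation fails on all of
  \<open>ereal\<close>, and \<open>L\<close> and \<open>N\<close> are required to correspond in both
  directions.\<close>

lemma distr_rescale_iff:
  fixes T :: "'a \<Rightarrow> ennreal"
  assumes T [measurable]: "T \<in> borel_measurable M" and "\<alpha> > 0" "\<kappa> \<ge> 0"
    and L: "distr L borel (\<lambda>y. e2ennreal (ereal \<alpha> * y + ereal \<kappa>)) = N"
    and N: "distr N borel (\<lambda>t. (enn2ereal t - ereal \<kappa>) / ereal \<alpha>) = L"
  shows "distr M borel (\<lambda>\<omega>. (enn2ereal (T \<omega>) - ereal \<kappa>) / ereal \<alpha>) = L \<longleftrightarrow> distr M borel T = N"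
proof
  have inv: "e2ennreal (ereal \<alpha> * ((enn2ereal t - ereal \<kappa>) / ereal \<alpha>) + ereal \<kappa>) = t" for t
    using \<open>\<alpha> > 0\<close> by (cases t) auto
  assume "distr M borel (\<lambda>\<omega>. (enn2ereal (T \<omega>) - ereal \<kappa>) / ereal \<alpha>) = L"
  then have "N = distr (distr M borel (\<lambda>\<omega>. (enn2ereal (T \<omega>) - ereal \<kappa>) / ereal \<alpha>)) borel
      (\<lambda>y. e2ennreal (ereal \<alpha> * y + ereal \<kappa>))"
    using L by simp
  also have "\<dots> = distr M borel T"
    by (subst distr_distr) (auto simp: o_def inv)
  finally show "distr M borel T = N" ..
next
  assume "distr M borel T = N"
  then have "L = distr (distr M borel T) borel (\<lambda>t. (enn2ereal t - ereal \<kappa>) / ereal \<alpha>)"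
    using N by simp
  then show "distr M borel (\<lambda>\<omega>. (enn2ereal (T \<omega>) - ereal \<kappa>) / ereal \<alpha>) = L"
    by (simp add: distr_distr o_def)
qed

lemma distr_affine_iff:
  fixes T :: "'a \<Rightarrow> ennreal" and f :: "'b \<Rightarrow> real"
  assumes T: "T \<in> borel_measurable M" and \<alpha>: "\<alpha> > 0" and \<kappa>: "\<kappa> \<ge> 0"
    and f [measurable]: "f \<in> borel_measurable D" and f_nonneg: "AE x in D. 0 \<le> f x"
  shows "distr M borel (\<lambda>\<omega>. (enn2ereal (T \<omega>) - ereal \<kappa>) / ereal \<alpha>) = distr D borel (\<lambda>x. ereal (f x)) \<longleftrightarrow>
    distr M borel T = distr D borel (\<lambda>x. ennreal (\<kappa> + \<alpha> * f x))"
proof (rule distr_rescale_iff[OF T \<alpha> \<kappa>])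
  show "distr (distr D borel (\<lambda>x. ereal (f x))) borel (\<lambda>y. e2ennreal (ereal \<alpha> * y + ereal \<kappa>)) =
      distr D borel (\<lambda>x. ennreal (\<kappa> + \<alpha> * f x))"
    by (subst distr_distr) (auto simp: o_def add.commute simp del: ennreal_plus)
  show "distr (distr D borel (\<lambda>x. ennreal (\<kappa> + \<alpha> * f x))) borel (\<lambda>t. (enn2ereal t - ereal \<kappa>) / ereal \<alpha>) =
      distr D borel (\<lambda>x. ereal (f x))"
    using f_nonneg \<alpha> \<kappa>
    by (subst distr_distr)
      (auto simp: o_def enn2ereal_ennreal simp del: ennreal_plus intro!: distr_cong_AE)
qed

lemma distr_mix_rescale_iff:
  fixes T :: "'a \<Rightarrow> ennreal" and f :: "'b \<Rightarrow> real"
  assumes T: "T \<in> borel_measurable M" and \<alpha>: "\<alpha> > 0"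
    and f [measurable]: "f \<in> borel_measurable D" and f_nonneg: "AE x in D. 0 \<le> f x"
  shows "distr M borel (\<lambda>\<omega>. enn2ereal (T \<omega>) / ereal \<alpha>) =
      mix q (return borel 0) (distr D borel (\<lambda>x. ereal (f x))) \<longleftrightarrow>
    distr M borel T = mix q (return borel 0) (distr D borel (\<lambda>x. ennreal (\<alpha> * f x)))"
proof -
  have "distr M borel (\<lambda>\<omega>. (enn2ereal (T \<omega>) - ereal 0) / ereal \<alpha>) =
      mix q (return borel 0) (distr D borel (\<lambda>x. ereal (f x))) \<longleftrightarrow>
    distr M borel T = mix q (return borel 0) (distr D borel (\<lambda>x. ennreal (\<alpha> * f x)))"
  proof (rule distr_rescale_iff[OF T \<alpha> order_refl])
    have "distr (distr D borel (\<lambda>x. ereal (f x))) borel (\<lambda>y. e2ennreal (ereal \<alpha> * y + ereal 0)) =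
        distr D borel (\<lambda>x. ennreal (\<alpha> * f x))"
      by (subst distr_distr) (auto simp: o_def)
    then show "distr (mix q (return borel 0) (distr D borel (\<lambda>x. ereal (f x)))) borel
        (\<lambda>y. e2ennreal (ereal \<alpha> * y + ereal 0)) =
        mix q (return borel 0) (distr D borel (\<lambda>x. ennreal (\<alpha> * f x)))"
      by (subst distr_mix) (auto simp: distr_return zero_ereal_def[symmetric] e2ennreal_neg)
    have "distr (distr D borel (\<lambda>x. ennreal (\<alpha> * f x))) borel (\<lambda>t. (enn2ereal t - ereal 0) / ereal \<alpha>) =
        distr D borel (\<lambda>x. ereal (f x))"
      using f_nonneg \<alpha>
      by (subst distr_distr) (auto simp: o_def enn2ereal_ennreal intro!: distr_cong_AE)
    then show "distr (mix q (return borel 0) (distr D borel (\<lambda>x. ennreal (\<alpha> * f x)))) borel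
        (\<lambda>t. (enn2ereal t - ereal 0) / ereal \<alpha>) =
        mix q (return borel 0) (distr D borel (\<lambda>x. ereal (f x)))"
      using \<alpha> by (subst distr_mix) (auto simp: distr_return zero_ereal_def[symmetric] zero_ennreal.rep_eq)
  qed
  then show ?thesis by (simp add: zero_ereal_def[symmetric])
qed

lemma (in prob_space) prob_eq_1_iff_distr_return:
  assumes T [measurable]: "T \<in> borel_measurable M"
  shows "prob {\<omega> \<in> space M. T \<omega> = c} = 1 \<longleftrightarrow> distr M borel T = return borel (c :: ennreal)"
proof
  assume "prob {\<omega> \<in> space M. T \<omega> = c} = 1"
  then have "AE \<omega> in M. T \<omega> = c"
    by (simp add: prob_Collect_eq_1)
  then have "distr M borel T = distr M borel (\<lambda>_. c)"
    by (intro distr_cong_AE) auto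
  then show "distr M borel T = return borel c" by simp
next
  assume eq: "distr M borel T = return borel c"
  have "prob {\<omega> \<in> space M. T \<omega> = c} = measure (distr M borel T) {c}"
    by (subst measure_distr) (auto intro!: arg_cong[where f=prob])
  then show "prob {\<omega> \<in> space M. T \<omega> = c} = 1"
    unfolding eq by (simp add: measure_return)
qed

lemma law_eq_iff_lap_moment:
  assumes "prob_space \<mu>" "sets \<mu> = sets borel" "prob_space \<nu>" "sets \<nu> = sets borel"
  shows "\<mu> = \<nu> \<longleftrightarrow> (\<forall>n\<ge>1. lap_moment \<mu> n = lap_moment \<nu> n)"
  using law_eqI_lap_moment[OF assms] by blast

text \<open>Replaces the shift \<kappa> by the factor C = exp (- \<kappa>) that occurs in the
  solutions of the functional equation.\<close>

lemma ex_exp_minus_nonneg: "(\<exists>\<kappa>::real. \<kappa> \<ge> 0 \<and> P (exp (- \<kappa>))) \<longleftrightarrow> (\<exists>C. 0 < C \<and> C \<le> 1 \<and> P C)"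
proof
  assume "\<exists>C. 0 < C \<and> C \<le> 1 \<and> P C"
  then obtain C where "0 < C" "C \<le> 1" "P C" by blast
  then show "\<exists>\<kappa>::real. \<kappa> \<ge> 0 \<and> P (exp (- \<kappa>))"
    by (intro exI[of _ "- ln C"]) auto
next
  assume "\<exists>\<kappa>::real. \<kappa> \<ge> 0 \<and> P (exp (- \<kappa>))"
  then obtain \<kappa> where "\<kappa> \<ge> 0" "P (exp (- \<kappa>))" by blast
  then show "\<exists>C. 0 < C \<and> C \<le> 1 \<and> P C"
    by (intro exI[of _ "exp (- \<kappa>)"]) auto
qed

lemma ex_exp_minus_pos: "(\<exists>\<alpha>::real. \<alpha> > 0 \<and> P (exp (- \<alpha>))) \<longleftrightarrow> (\<exists>z. 0 < z \<and> z < 1 \<and> P z)"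
proof
  assume "\<exists>z. 0 < z \<and> z < 1 \<and> P z"
  then obtain z where "0 < z" "z < 1" "P z" by blast
  then show "\<exists>\<alpha>::real. \<alpha> > 0 \<and> P (exp (- \<alpha>))"
    by (intro exI[of _ "- ln z"]) auto
next
  assume "\<exists>\<alpha>::real. \<alpha> > 0 \<and> P (exp (- \<alpha>))"
  then obtain \<alpha> where "\<alpha> > 0" "P (exp (- \<alpha>))" by blast
  then show "\<exists>z. 0 < z \<and> z < 1 \<and> P z"
    by (intro exI[of _ "exp (- \<alpha>)"]) auto
qed

context
  fixes M :: "'a measure" and T :: "nat \<Rightarrow> 'a \<Rightarrow> ennreal"
  assumes M: "prob_space M"
    and T_measurable [measurable]: "T 1 \<in> borel_measurable M" "T 2 \<in> borel_measurable M"
begin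

interpretation prob_space M by (fact M)

private abbreviation (input) "law n \<equiv> distr M borel (T n)"

private lemma law: "prob_space (law 1)" "sets (law 1) = sets borel" "prob_space (law 2)" "sets (law 2) = sets borel"
  using T_measurable by (auto intro: prob_space_distr)

private lemmas law_iff = law_eq_iff_lap_moment[OF law(1,2)] law_eq_iff_lap_moment[OF law(3,4)]

text \<open>The moments are nonnegative and decreasing in the order, so a vanishing first moment
  annihilates all of them, and these are the moments of the Dirac measure at infinity.\<close>

lemma clause_a_iff: "clause_holds M T Clause_a \<longleftrightarrow> lap_moment (law 1) 1 = 0"
proof -
  have "lap_moment (law 1) n = 0" if "lap_moment (law 1) 1 = 0" "n \<ge> 1" for n
    using that(2)
  proof (induction n rule: dec_induct)
    case (step n)
    then show ?case
      using lap_moment_Suc_le[OF law(1,2), of n] lap_moment_nonneg[OF law(1,2), of "Suc n"] by simp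
  qed (fact that(1))
  then have "(\<forall>n\<ge>1. lap_moment (law 1) n = 0) \<longleftrightarrow> lap_moment (law 1) 1 = 0" by blast
  then show ?thesis
    by (simp add: prob_eq_1_iff_distr_return law_iff prob_space_return power_0_left del: One_nat_def)
qed

lemma clause_b_iff: "clause_holds M T Clause_b \<longleftrightarrow>
    (\<exists>C. 0 < C \<and> C \<le> 1 \<and> (\<forall>n\<ge>1. lap_moment (law 1) n = C ^ n) \<and> (\<forall>n\<ge>1. lap_moment (law 2) n = 1))"
proof -
  have 1: "prob {\<omega> \<in> space M. T 1 \<omega> = ennreal \<kappa>} = 1 \<longleftrightarrow>
      (\<forall>n\<ge>1. lap_moment (law 1) n = exp (- \<kappa>) ^ n)" if "\<kappa> \<ge> 0" for \<kappa>
    unfolding prob_eq_1_iff_distr_return[OF T_measurable(1)] using that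
    by (subst law_iff) (auto simp: prob_space_return lap_ennreal)
  have 2: "prob {\<omega> \<in> space M. T 2 \<omega> = 0} = 1 \<longleftrightarrow> (\<forall>n\<ge>1. lap_moment (law 2) n = 1)"
    unfolding prob_eq_1_iff_distr_return[OF T_measurable(2)]
    by (subst law_iff) (auto simp: prob_space_return)
  show ?thesis
    unfolding ex_exp_minus_nonneg[symmetric] clause_holds.simps
    by (simp add: 1 2 conj_commute del: One_nat_def cong: conj_cong)
qed

lemma clause_c_iff: "clause_holds M T Clause_c \<longleftrightarrow>
    (\<exists>C. 0 < C \<and> C \<le> 1 \<and> (\<exists>q. 0 < q \<and> q < 1 \<and>
      (\<forall>n\<ge>1. lap_moment (law 1) n = C ^ n * (1 - q\<^sup>2)) \<and> (\<forall>n\<ge>1. lap_moment (law 2) n = 1 - q)))"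
proof -
  have 1: "law 1 = mix (q\<^sup>2) (return borel (ennreal \<kappa>)) (return borel \<infinity>) \<longleftrightarrow>
      (\<forall>n\<ge>1. lap_moment (law 1) n = exp (- \<kappa>) ^ n * (1 - q\<^sup>2))"
    if "\<kappa> \<ge> 0" "0 < q" "q < 1" for \<kappa> q :: real
    using that by (subst law_iff)
      (auto simp: prob_space_mix prob_space_return lap_moment_mix lap_ennreal power_0_left power_le_one mult.commute)
  have 2: "law 2 = mix q (return borel 0) (return borel \<infinity>) \<longleftrightarrow> (\<forall>n\<ge>1. lap_moment (law 2) n = 1 - q)"
    if "0 < q" "q < 1" for q :: real
    using that by (subst law_iff)
      (auto simp: prob_space_mix prob_space_return lap_moment_mix power_0_left)
  show ?thesis
    unfolding ex_exp_minus_nonneg[symmetric] clause_holds.simps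
    by (simp add: 1[unfolded infinity_ennreal_def] 2[unfolded infinity_ennreal_def] del: One_nat_def cong: conj_cong)
qed

lemma clause_d_iff: "clause_holds M T Clause_d \<longleftrightarrow>
    (\<exists>C. 0 < C \<and> C \<le> 1 \<and> (\<exists>\<theta>>0.
      (\<forall>n\<ge>1. lap_moment (law 1) n = C ^ n * (\<theta> / (\<theta> + real n))) \<and>
      (\<forall>n\<ge>1. lap_moment (law 2) n = \<theta> / (\<theta> + real n))))"
proof -
  have *: "distr M borel (\<lambda>\<omega>. enn2ereal (T i \<omega>) - ereal \<kappa>) = Exp_law \<theta> \<longleftrightarrow>
      law i = shifted_exp_law \<kappa> \<theta>"
    if "\<kappa> \<ge> 0" "\<theta> > 0" and [measurable]: "T i \<in> borel_measurable M" for i \<kappa> \<theta>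
  proof -
    have "AE x in density lborel (\<lambda>x. ennreal (exponential_density \<theta> x)). 0 \<le> x"
      by (subst AE_density) (auto simp: exponential_density_def)
    from distr_affine_iff[OF that(3) zero_less_one that(1) _ this] show ?thesis
      by (simp add: Exp_law_def shifted_exp_law_def one_ereal_def[symmetric])
  qed
  have 1: "distr M borel (\<lambda>\<omega>. enn2ereal (T 1 \<omega>) - ereal \<kappa>) = Exp_law \<theta> \<longleftrightarrow>
      (\<forall>n\<ge>1. lap_moment (law 1) n = exp (- \<kappa>) ^ n * (\<theta> / (\<theta> + real n)))"
    if "\<kappa> \<ge> 0" "\<theta> > 0" for \<kappa> \<theta>
    unfolding *[OF that T_measurable(1)] using that
    by (simp add: law_iff prob_space_shifted_exp_law lap_moment_shifted_exp_law del: One_nat_def)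
  have 2: "distr M borel (\<lambda>\<omega>. enn2ereal (T 2 \<omega>)) = Exp_law \<theta> \<longleftrightarrow>
      (\<forall>n\<ge>1. lap_moment (law 2) n = \<theta> / (\<theta> + real n))"
    if "\<theta> > 0" for \<theta>
    using *[OF order_refl that T_measurable(2)] that
    by (simp add: law_iff prob_space_shifted_exp_law lap_moment_shifted_exp_law zero_ereal_def[symmetric])
  show ?thesis
    unfolding ex_exp_minus_nonneg[symmetric] clause_holds.simps
    by (simp add: 1 2 del: One_nat_def cong: conj_cong)
qed

lemma clause_e_iff: "clause_holds M T Clause_e \<longleftrightarrow>
    (\<exists>q. 0 < q \<and> q < 1 \<and> (\<exists>C. 0 < C \<and> C \<le> 1 \<and> (\<exists>z. 0 < z \<and> z < 1 \<and>
      (\<forall>n\<ge>1. lap_moment (law 1) n = C ^ n * ((1 - q\<^sup>2) / (1 - q\<^sup>2 * z ^ n))) \<and>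
      (\<forall>n\<ge>1. lap_moment (law 2) n = (1 - q) + q * ((1 - q\<^sup>2) * z ^ n / (1 - q\<^sup>2 * z ^ n))))))"
  (is "_ \<longleftrightarrow> ?thesis_rhs")
proof -
  have 1: "distr M borel (\<lambda>\<omega>. (enn2ereal (T 1 \<omega>) - ereal \<kappa>) / ereal \<alpha>) = geom_N0 (1 - q\<^sup>2) \<longleftrightarrow>
      (\<forall>n\<ge>1. lap_moment (law 1) n = exp (- \<kappa>) ^ n * ((1 - q\<^sup>2) / (1 - q\<^sup>2 * exp (- \<alpha>) ^ n)))"
    if "\<kappa> \<ge> 0" "\<alpha> > 0" "0 < q" "q < 1" for \<kappa> \<alpha> q
  proof -
    have q: "0 < 1 - q\<^sup>2" "1 - q\<^sup>2 < 1" using that by (auto simp: abs_square_less_1)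
    have "distr M borel (\<lambda>\<omega>. (enn2ereal (T 1 \<omega>) - ereal \<kappa>) / ereal \<alpha>) = geom_N0 (1 - q\<^sup>2) \<longleftrightarrow>
        law 1 = affine_geom_law \<kappa> \<alpha> (1 - q\<^sup>2)"
      unfolding geom_N0_def affine_geom_law_def using that by (intro distr_affine_iff T_measurable) auto
    then show ?thesis
      using that lap_moment_affine_geom_law[OF that(1) less_imp_le[OF that(2)] q]
      by (simp add: law_iff prob_space_affine_geom_law del: One_nat_def)
  qed
  have 2: "distr M borel (\<lambda>\<omega>. enn2ereal (T 2 \<omega>) / ereal \<alpha>) = mix q (return borel 0) (geom_N (1 - q\<^sup>2)) \<longleftrightarrow>
      (\<forall>n\<ge>1. lap_moment (law 2) n =
        (1 - q) + q * ((1 - q\<^sup>2) * exp (- \<alpha>) ^ n / (1 - q\<^sup>2 * exp (- \<alpha>) ^ n)))"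
    if "\<alpha> > 0" "0 < q" "q < 1" for \<alpha> q
  proof -
    have q: "0 < 1 - q\<^sup>2" "1 - q\<^sup>2 < 1" using that by (auto simp: abs_square_less_1)
    have "distr M borel (\<lambda>\<omega>. enn2ereal (T 2 \<omega>) / ereal \<alpha>) = mix q (return borel 0) (geom_N (1 - q\<^sup>2)) \<longleftrightarrow>
        law 2 = mix q (return borel 0)
          (distr (measure_pmf (geometric_pmf (1 - q\<^sup>2))) borel (\<lambda>k. ennreal (\<alpha> * real (Suc k))))"
      unfolding geom_N_def using that by (intro distr_mix_rescale_iff T_measurable) auto
    also have "distr (measure_pmf (geometric_pmf (1 - q\<^sup>2))) borel (\<lambda>k. ennreal (\<alpha> * real (Suc k))) =
        affine_geom_law \<alpha> \<alpha> (1 - q\<^sup>2)"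
      by (simp add: affine_geom_law_def algebra_simps del: ennreal_plus)
    finally show ?thesis
      using that lap_moment_affine_geom_law[OF less_imp_le[OF that(1)] less_imp_le[OF that(1)] q]
      by (simp add: law_iff prob_space_mix prob_space_return prob_space_affine_geom_law lap_moment_mix mult_ac)
  qed
  have "clause_holds M T Clause_e \<longleftrightarrow>
    (\<exists>q. 0 < q \<and> q < 1 \<and> (\<exists>\<kappa>. \<kappa> \<ge> 0 \<and> (\<exists>\<alpha>. \<alpha> > 0 \<and>
      (\<forall>n\<ge>1. lap_moment (law 1) n = exp (- \<kappa>) ^ n * ((1 - q\<^sup>2) / (1 - q\<^sup>2 * exp (- \<alpha>) ^ n))) \<and>
      (\<forall>n\<ge>1. lap_moment (law 2) n =
        (1 - q) + q * ((1 - q\<^sup>2) * exp (- \<alpha>) ^ n / (1 - q\<^sup>2 * exp (- \<alpha>) ^ n))))))"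
    by (simp add: 1 2 del: One_nat_def cong: conj_cong)
  also have "\<dots> \<longleftrightarrow> ?thesis_rhs"
    \<comment> \<open>The bounds on q have the same shape as those on z. Its quantifier is stripped
      first so that only z is rewritten as exp (- \<alpha>).\<close>
    apply (rule ex_cong1, rule conj_cong[OF refl], rule conj_cong[OF refl])
    unfolding ex_exp_minus_nonneg[symmetric] ex_exp_minus_pos[symmetric] by (rule refl)
  finally show ?thesis .
qed

end

section \<open>Joint moments of the first arrivals\<close>

text \<open>The joint law of the images under \<open>lap\<close> and the product of its marginals
  live on the unit square, where monomials determine a measure. Moments with an exponent 0 factor
  trivially. Applying \<open>unlap\<close> to both coordinates returns to the original
  variables.\<close>

lemma (in prob_space) indep_var_iff_lap_moments:
  fixes U V :: "'a \<Rightarrow> ennreal"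
  assumes [measurable]: "U \<in> borel_measurable M" "V \<in> borel_measurable M"
  shows "indep_var borel U borel V \<longleftrightarrow>
    (\<forall>m\<ge>1. \<forall>n\<ge>1. expectation (\<lambda>\<omega>. lap (U \<omega>) ^ m * lap (V \<omega>) ^ n) =
      expectation (\<lambda>\<omega>. lap (U \<omega>) ^ m) * expectation (\<lambda>\<omega>. lap (V \<omega>) ^ n))"
proof (intro iffI allI impI)
  have int: "integrable M (\<lambda>\<omega>. lap (W \<omega>) ^ n)" if [measurable]: "W \<in> borel_measurable M" for W n
    by (rule integrable_const_bound[where B=1]) auto
  {
    fix m n :: nat
    assume "indep_var borel U borel V"
    then have "indep_var borel ((\<lambda>x. lap x ^ m) \<circ> U) borel ((\<lambda>x. lap x ^ n) \<circ> V)"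
      by (rule indep_var_compose) auto
    then show "expectation (\<lambda>\<omega>. lap (U \<omega>) ^ m * lap (V \<omega>) ^ n) =
      expectation (\<lambda>\<omega>. lap (U \<omega>) ^ m) * expectation (\<lambda>\<omega>. lap (V \<omega>) ^ n)"
      by (intro indep_var_lebesgue_integral int) (auto simp: o_def)
  }
  assume "\<forall>m\<ge>1. \<forall>n\<ge>1. expectation (\<lambda>\<omega>. lap (U \<omega>) ^ m * lap (V \<omega>) ^ n) =
      expectation (\<lambda>\<omega>. lap (U \<omega>) ^ m) * expectation (\<lambda>\<omega>. lap (V \<omega>) ^ n)"
  then have mom: "expectation (\<lambda>\<omega>. lap (U \<omega>) ^ m * lap (V \<omega>) ^ n) =
      expectation (\<lambda>\<omega>. lap (U \<omega>) ^ m) * expectation (\<lambda>\<omega>. lap (V \<omega>) ^ n)" for m n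
    by (cases "m = 0 \<or> n = 0") (auto simp: prob_space)
  define A B where "A = distr M borel (\<lambda>\<omega>. lap (U \<omega>))" and "B = distr M borel (\<lambda>\<omega>. lap (V \<omega>))"
  have sets_AB [simp, measurable_cong]: "sets A = sets borel" "sets B = sets borel"
    by (simp_all add: A_def B_def)
  interpret A: prob_space A unfolding A_def by (rule prob_space_distr) simp
  interpret B: prob_space B unfolding B_def by (rule prob_space_distr) simp
  interpret AB: pair_prob_space A B ..
  have AE_A: "AE x in A. x \<in> {0..1}"
    unfolding A_def by (subst AE_distr_iff) auto
  have AE_B: "AE x in B. x \<in> {0..1}"
    unfolding B_def by (subst AE_distr_iff) auto
  have AE_AB: "AE z in A \<Otimes>\<^sub>M B. z \<in> {0..1} \<times> {0..1}"
  proof (rule AB.AE_pair_measure)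
    show "{z \<in> space (A \<Otimes>\<^sub>M B). z \<in> {0..1} \<times> {0..1}} \<in> sets (A \<Otimes>\<^sub>M B)"
      by measurable
    show "AE x in A. AE y in B. (x, y) \<in> {0..1} \<times> {0..1}"
      using AE_A by eventually_elim (use AE_B in auto)
  qed
  have sets_pair: "sets (A \<Otimes>\<^sub>M B) = sets borel"
    unfolding sets_pair_measure_cong[OF sets_AB] borel_prod ..
  have sets_borel_pair: "sets (borel \<Otimes>\<^sub>M borel :: (real \<times> real) measure) = sets borel"
    unfolding borel_prod ..
  have "A \<Otimes>\<^sub>M B = distr M (borel \<Otimes>\<^sub>M borel) (\<lambda>\<omega>. (lap (U \<omega>), lap (V \<omega>)))"
  proof (rule measure_eqI_moments[where K="{0..1} \<times> {0..1}"
        and G="range (\<lambda>(m, n) z. fst z ^ m * snd z ^ n)"])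
    show "prob_space (distr M (borel \<Otimes>\<^sub>M borel) (\<lambda>\<omega>. (lap (U \<omega>), lap (V \<omega>))))"
      by (rule prob_space_distr) measurable
    show "AE z in distr M (borel \<Otimes>\<^sub>M borel) (\<lambda>\<omega>. (lap (U \<omega>), lap (V \<omega>))). z \<in> {0..1} \<times> {0..1}"
      by (subst AE_distr_iff) auto
    show "continuous_on UNIV g" if "g \<in> range (\<lambda>(m, n) (z::real \<times> real). fst z ^ m * snd z ^ n)" for g
      using that by (auto intro!: continuous_intros)
    show "(\<lambda>_. 1) \<in> range (\<lambda>(m, n) (z::real \<times> real). fst z ^ m * snd z ^ n)"
      by (rule image_eqI[of _ _ "(0, 0)"]) auto
    show "(\<lambda>z. f z * h z) \<in> range (\<lambda>(m, n) (z::real \<times> real). fst z ^ m * snd z ^ n)"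
      if f: "f \<in> range (\<lambda>(m, n) z. fst z ^ m * snd z ^ n)" and h: "h \<in> range (\<lambda>(m, n) z. fst z ^ m * snd z ^ n)" for f h
    proof -
      obtain x where x: "f = (\<lambda>(m, n) z. fst z ^ m * snd z ^ n) x" using f by (rule rangeE)
      obtain y where y: "h = (\<lambda>(m, n) z. fst z ^ m * snd z ^ n) y" using h by (rule rangeE)
      show ?thesis
        by (intro image_eqI[of _ _ "(fst x + fst y, snd x + snd y)"])
          (auto simp: x y power_add mult_ac split: prod.split)
    qed
    show "\<exists>g\<in>range (\<lambda>(m, n) z. fst z ^ m * snd z ^ n). g x \<noteq> g y" if "x \<noteq> y" for x y :: "real \<times> real"
    proof (cases "fst x = fst y")
      case True
      then show ?thesis using that
        by (intro bexI[of _ "\<lambda>z. fst z ^ 0 * snd z ^ 1"] image_eqI[of _ _ "(0, 1)"]) (auto simp: prod_eq_iff)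
    next
      case False
      then show ?thesis
        by (intro bexI[of _ "\<lambda>z. fst z ^ 1 * snd z ^ 0"] image_eqI[of _ _ "(1, 0)"]) auto
    qed
    show "(\<integral>z. g z \<partial>(A \<Otimes>\<^sub>M B)) = (\<integral>z. g z \<partial>distr M (borel \<Otimes>\<^sub>M borel) (\<lambda>\<omega>. (lap (U \<omega>), lap (V \<omega>))))"
      if g_range: "g \<in> range (\<lambda>(m, n) z. fst z ^ m * snd z ^ n)" for g
    proof -
      obtain m n where g: "g = (\<lambda>z. fst z ^ m * snd z ^ n)" using g_range by auto
      have [measurable]: "g \<in> borel_measurable (borel \<Otimes>\<^sub>M borel)"
        unfolding g by measurable
      have "integrable (A \<Otimes>\<^sub>M B) g"
      proof (rule AB.integrable_const_bound[where B=1])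
        show "AE z in A \<Otimes>\<^sub>M B. norm (g z) \<le> 1"
          using AE_AB by eventually_elim
            (auto simp: g abs_mult power_abs intro!: mult_le_one power_le_one)
      qed measurable
      then have "(\<integral>z. g z \<partial>(A \<Otimes>\<^sub>M B)) = (\<integral>x. (\<integral>y. g (x, y) \<partial>B) \<partial>A)"
        by (rule AB.integral_fst'[symmetric])
      also have "\<dots> = (\<integral>x. x ^ m \<partial>A) * (\<integral>y. y ^ n \<partial>B)"
        by (simp add: g)
      also have "\<dots> = expectation (\<lambda>\<omega>. lap (U \<omega>) ^ m * lap (V \<omega>) ^ n)"
        unfolding mom by (simp add: A_def B_def integral_distr)
      also have "\<dots> = (\<integral>z. g z \<partial>distr M (borel \<Otimes>\<^sub>M borel) (\<lambda>\<omega>. (lap (U \<omega>), lap (V \<omega>))))"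
        by (subst integral_distr) (auto simp: g)
      finally show ?thesis .
    qed
  qed (use sets_pair sets_borel_pair AE_AB AB.prob_space_axioms in \<open>simp_all add: compact_Times\<close>)
  then have "indep_var borel (\<lambda>\<omega>. lap (U \<omega>)) borel (\<lambda>\<omega>. lap (V \<omega>))"
    unfolding indep_var_distribution_eq by (simp add: A_def B_def)
  from indep_var_compose[OF this, of unlap borel unlap borel]
  show "indep_var borel U borel V"
    by (simp add: o_def)
qed

section \<open>First arrivals as series over the index of the first point of a type\<close>

lemma one_le_arrival_count_iff:
  "1 \<le> arrival_count T X i t \<omega> \<longleftrightarrow> (\<exists>n. arrival_time T (Suc n) \<omega> \<le> t \<and> X (Suc n) \<omega> = i)"
proof
  assume *: "1 \<le> arrival_count T X i t \<omega>"
  show "\<exists>n. arrival_time T (Suc n) \<omega> \<le> t \<and> X (Suc n) \<omega> = i"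
  proof (rule ccontr)
    assume "\<not> ?thesis"
    then have "(\<lambda>n. of_bool (arrival_time T (Suc n) \<omega> \<le> t \<and> X (Suc n) \<omega> = i) :: ennreal) = (\<lambda>_. 0)"
      by auto
    then have "arrival_count T X i t \<omega> = 0" by (simp add: arrival_count_def)
    then show False using * by simp
  qed
next
  assume "\<exists>n. arrival_time T (Suc n) \<omega> \<le> t \<and> X (Suc n) \<omega> = i"
  then obtain n where n: "arrival_time T (Suc n) \<omega> \<le> t \<and> X (Suc n) \<omega> = i" by blast
  show "1 \<le> arrival_count T X i t \<omega>"
    unfolding arrival_count_def
    using sum_le_suminf[of "\<lambda>n. of_bool (arrival_time T (Suc n) \<omega> \<le> t \<and> X (Suc n) \<omega> = i) :: ennreal" "{n}"] n
    by auto
qed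

lemma arrival_time_mono: "m \<le> n \<Longrightarrow> arrival_time T m \<omega> \<le> arrival_time T n \<omega>"
  unfolding arrival_time_def by (intro sum_mono2) auto

lemma lap_arrival_time: "lap (arrival_time T n \<omega>) = (\<Prod>j=1..n. lap (T j \<omega>))"
  by (simp add: arrival_time_def lap_sum)

text \<open>Arrival times are nondecreasing in the index, so the point of least index is a first
  one, ties included. If its time is infinite, no finite t is in the set and the infimum is infinite
  as well.\<close>

lemma first_arrival_eq_arrival_time:
  assumes "X (Suc k) \<omega> = i" "\<And>j. 1 \<le> j \<Longrightarrow> j \<le> k \<Longrightarrow> X j \<omega> \<noteq> i"
  shows "first_arrival T X i \<omega> = arrival_time T (Suc k) \<omega>"
  unfolding first_arrival_def one_le_arrival_count_iff
proof (rule antisym)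
  show "Inf {t. t < \<infinity> \<and> (\<exists>n. arrival_time T (Suc n) \<omega> \<le> t \<and> X (Suc n) \<omega> = i)} \<le> arrival_time T (Suc k) \<omega>"
  proof (cases "arrival_time T (Suc k) \<omega> = \<infinity>")
    case False
    then show ?thesis
      using assms(1) by (intro Inf_lower) (auto simp: less_top)
  qed simp
  show "arrival_time T (Suc k) \<omega> \<le> Inf {t. t < \<infinity> \<and> (\<exists>n. arrival_time T (Suc n) \<omega> \<le> t \<and> X (Suc n) \<omega> = i)}"
  proof (rule Inf_greatest, safe)
    fix t n assume n: "arrival_time T (Suc n) \<omega> \<le> t" "i = X (Suc n) \<omega>"
    then have "Suc k \<le> Suc n"
      using assms(2)[of "Suc n"] by force
    from order_trans[OF arrival_time_mono[OF this] n(1)]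
    show "arrival_time T (Suc k) \<omega> \<le> t" .
  qed
qed

lemma first_arrival_eq_infinity:
  assumes "\<And>n. X (Suc n) \<omega> \<noteq> i"
  shows "first_arrival T X i \<omega> = \<infinity>"
  using assms by (simp add: first_arrival_def one_le_arrival_count_iff)

text \<open>The indicator that \<open>Suc k\<close> is the least index of type i. Writing it as a
  product with one factor per index lets its expectation factor by independence.\<close>

definition first_at :: "(nat \<Rightarrow> 'a \<Rightarrow> nat) \<Rightarrow> nat \<Rightarrow> nat \<Rightarrow> 'a \<Rightarrow> real" where
  "first_at X i k \<omega> = (\<Prod>j=1..Suc k. of_bool ((X j \<omega> = i) = (j = Suc k)))"

lemma first_at_eq_of_bool:
  "first_at X i k \<omega> = of_bool (X (Suc k) \<omega> = i \<and> (\<forall>j. 1 \<le> j \<longrightarrow> j \<le> k \<longrightarrow> X j \<omega> \<noteq> i))"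
proof -
  have "(\<Prod>j=1..k. of_bool ((X j \<omega> = i) = (j = Suc k)) :: real) = (\<Prod>j=1..k. of_bool (X j \<omega> \<noteq> i))"
    by (intro prod.cong) auto
  also have "\<dots> = of_bool (\<forall>j. 1 \<le> j \<longrightarrow> j \<le> k \<longrightarrow> X j \<omega> \<noteq> i)"
    by (induction k) (auto simp: le_Suc_eq)
  finally show ?thesis by (auto simp: first_at_def)
qed

text \<open>At most one term is nonzero. If type i never occurs, all terms vanish and the first
  arrival is infinite, so the right side is 0 ^ n; this is where n \<ge> 1 enters. The identity
  holds at every point, without exceptional null sets.\<close>

lemma first_at_sums_lap_first_arrival:
  assumes "n \<ge> 1"
  shows "(\<lambda>k. first_at X i k \<omega> * (\<Prod>j=1..Suc k. lap (T j \<omega>)) ^ n) sums lap (first_arrival T X i \<omega>) ^ n"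
proof (cases "\<exists>k. X (Suc k) \<omega> = i")
  case False
  then show ?thesis
    using assms by (simp add: first_at_eq_of_bool first_arrival_eq_infinity power_0_left)
next
  case True
  define k where "k = (LEAST k. X (Suc k) \<omega> = i)"
  have k: "X (Suc k) \<omega> = i" unfolding k_def using True by (rule LeastI_ex)
  have less: "X j \<omega> \<noteq> i" if "1 \<le> j" "j \<le> k" for j
    using that not_less_Least[of "j - 1" "\<lambda>k. X (Suc k) \<omega> = i"] by (auto simp: k_def)
  have zero: "first_at X i l \<omega> = 0" if "l \<noteq> k" for l
  proof (cases "l < k")
    case True
    then show ?thesis using less[of "Suc l"] by (simp add: first_at_eq_of_bool)
  next
    case False
    then have "1 \<le> Suc k" "Suc k \<le> l" using that by auto
    then show ?thesis using k unfolding first_at_eq_of_bool by auto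
  qed
  have one: "first_at X i k \<omega> = 1"
    using k less by (simp add: first_at_eq_of_bool)
  have "first_arrival T X i \<omega> = arrival_time T (Suc k) \<omega>"
    by (rule first_arrival_eq_arrival_time) (use k less in auto)
  then have "lap (first_arrival T X i \<omega>) = (\<Prod>j=1..Suc k. lap (T j \<omega>))"
    by (simp only: lap_arrival_time)
  then show ?thesis
    using sums_finite[of "{k}" "\<lambda>k. first_at X i k \<omega> * (\<Prod>j=1..Suc k. lap (T j \<omega>)) ^ n"] zero one
    by simp
qed

text \<open>Independence of T and X is given through the sigma-algebras of the whole sequences;
  measurable functions of the sequences generate smaller ones.\<close>

lemma (in prob_space) indep_var_comp_of_indep_set:
  assumes indep: "indep_set (sets (vimage_algebra (space M) U N)) (sets (vimage_algebra (space M) V K))"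
    and U: "U \<in> measurable M N" and V: "V \<in> measurable M K"
    and f: "f \<in> measurable N L" and h: "h \<in> measurable K L"
  shows "indep_var L (f \<circ> U) L (h \<circ> V)"
proof -
  have sub: "sigma_sets (space M) {(f \<circ> W) -` A \<inter> space M |A. A \<in> sets L} \<subseteq> sets (vimage_algebra (space M) W Q)"
    if W: "W \<in> measurable M Q" and f: "f \<in> measurable Q L" for f W Q
  proof -
    have "W \<in> space M \<rightarrow> space Q"
      using W by (auto dest: measurable_space)
    then have "W \<in> measurable (vimage_algebra (space M) W Q) Q"
      by (rule measurable_vimage_algebra1)
    from measurable_comp[OF this f] have "{(f \<circ> W) -` A \<inter> space M |A. A \<in> sets L} \<subseteq> sets (vimage_algebra (space M) W Q)"
      by (auto dest: measurable_sets)
    from sets.sigma_sets_subset[OF this] show ?thesis by simp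
  qed
  show ?thesis
    unfolding indep_var_eq
  proof (intro conjI)
    show "indep_set (sigma_sets (space M) {(f \<circ> U) -` A \<inter> space M |A. A \<in> sets L})
        (sigma_sets (space M) {(h \<circ> V) -` A \<inter> space M |A. A \<in> sets L})"
      using indep sub[OF U f] sub[OF V h] unfolding indep_set_def
      by (elim indep_sets_mono_sets) (auto split: bool.split)
  qed (use U V f h in \<open>auto intro: measurable_comp\<close>)
qed

section \<open>Expectations under the hypotheses on T and X\<close>

locale two_type_arrivals = prob_space M for M :: "'a measure" +
  fixes p :: real and T :: "nat \<Rightarrow> 'a \<Rightarrow> ennreal" and X :: "nat \<Rightarrow> 'a \<Rightarrow> nat"
  assumes p: "0 < p" "p < 1"
    and T_indep: "indep_vars (\<lambda>_. borel) T {1..}"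
    and T_law: "\<And>j. j \<ge> 2 \<Longrightarrow> distr M borel (T j) = distr M borel (T 2)"
    and X_indep: "indep_vars (\<lambda>_. count_space {0, 1}) X {1..}"
    and X_law: "\<And>i. i \<ge> 1 \<Longrightarrow> distr M (count_space {0, 1}) (X i) = distr M (count_space {0, 1}) (X 1)"
    and X_1: "prob {\<omega> \<in> space M. X 1 \<omega> = 1} = p"
    and X_0: "prob {\<omega> \<in> space M. X 1 \<omega> = 0} = 1 - p"
    and T_X_indep: "indep_set
           (sets (vimage_algebra (space M) (\<lambda>\<omega>. \<lambda>i\<in>{1..}. T i \<omega>) (PiM {1..} (\<lambda>_. borel))))
           (sets (vimage_algebra (space M) (\<lambda>\<omega>. \<lambda>i\<in>{1..}. X i \<omega>)
              (PiM {1..} (\<lambda>_. count_space {0, 1}))))"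
begin

lemma T_measurable [measurable]: "i \<ge> 1 \<Longrightarrow> T i \<in> borel_measurable M"
  using T_indep by (simp add: indep_vars_def)

lemma X_measurable: "i \<ge> 1 \<Longrightarrow> X i \<in> measurable M (count_space {0, 1})"
  using X_indep by (simp add: indep_vars_def)

lemma X_range: "i \<ge> 1 \<Longrightarrow> \<omega> \<in> space M \<Longrightarrow> X i \<omega> = 0 \<or> X i \<omega> = 1"
  using measurable_space[OF X_measurable, of i \<omega>] by auto

lemma X_eq_measurable [measurable]: "i \<ge> 1 \<Longrightarrow> Measurable.pred M (\<lambda>\<omega>. X i \<omega> = c)"
  by (rule measurable_compose[OF X_measurable]) auto

definition type_prob :: "nat \<Rightarrow> real" where
  "type_prob i = (if i = 1 then p else 1 - p)"

lemma type_prob_bounds: "0 < type_prob i" "type_prob i < 1"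
  using p by (auto simp: type_prob_def)

lemma prob_X_eq:
  assumes "j \<ge> 1" "i \<in> {0, 1}"
  shows "prob {\<omega> \<in> space M. X j \<omega> = i} = type_prob i"
proof -
  have *: "measure (distr M (count_space {0, 1}) (X j)) {i} = prob {\<omega> \<in> space M. X j \<omega> = i}"
    if "j \<ge> 1" for j
    using assms X_measurable[OF that]
    by (subst measure_distr) (auto intro!: arg_cong[where f=prob])
  have "prob {\<omega> \<in> space M. X j \<omega> = i} = prob {\<omega> \<in> space M. X 1 \<omega> = i}"
    using *[of j] *[of 1] X_law[OF assms(1)] assms(1) by simp
  then show ?thesis using assms X_0 X_1 by (auto simp: type_prob_def)
qed

lemma expectation_X_eq:
  assumes "j \<ge> 1" "i \<in> {0, 1}"
  shows "expectation (\<lambda>\<omega>. of_bool ((X j \<omega> = i) = b)) = (if b then type_prob i else 1 - type_prob i)"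
proof -
  note [measurable] = X_eq_measurable[OF assms(1)]
  have "expectation (\<lambda>\<omega>. of_bool (X j \<omega> = i) :: real) =
      expectation (indicator {\<omega> \<in> space M. X j \<omega> = i})"
    by (intro Bochner_Integration.integral_cong) auto
  also have "\<dots> = prob {\<omega> \<in> space M. X j \<omega> = i}"
    by (simp add: Int_absorb2)
  finally have 1: "expectation (\<lambda>\<omega>. of_bool (X j \<omega> = i) :: real) = type_prob i"
    using prob_X_eq[OF assms] by simp
  have "integrable M (\<lambda>\<omega>. of_bool (X j \<omega> = i) :: real)"
    by (rule integrable_const_bound[where B=1]) auto
  then have "expectation (\<lambda>\<omega>. 1 - of_bool (X j \<omega> = i)) = 1 - type_prob i"
    using 1 by (simp add: prob_space)
  then show ?thesis using 1 by (cases b) (simp_all add: of_bool_not_iff)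
qed

text \<open>The indicator depends on X and the product on T, so the two separate and each then
  factors over the indices. \<open>T 1\<close> has its own law and its own exponent l, because it
  will also occur in a second factor of a joint moment.\<close>

lemma expectation_first_at:
  assumes "i \<in> {0, 1}"
  shows "expectation (\<lambda>\<omega>. first_at X i k \<omega> * (\<Prod>j=1..Suc k. lap (T j \<omega>) ^ (if j = 1 then l else n))) =
    (1 - type_prob i) ^ k * type_prob i * (lap_moment (distr M borel (T 1)) l * lap_moment (distr M borel (T 2)) n ^ k)"
proof -
  let ?J = "{1..Suc k}"
  let ?f = "\<lambda>x. \<Prod>j\<in>?J. of_bool ((x j = i) = (j = Suc k)) :: real"
  let ?h = "\<lambda>t. \<Prod>j\<in>?J. lap (t j) ^ (if j = 1 then l else n)"
  let ?TT = "\<lambda>\<omega>. \<lambda>i\<in>{1..}. T i \<omega>" and ?XX = "(\<lambda>\<omega>. \<lambda>i\<in>{1..}. X i \<omega>) :: 'a \<Rightarrow> nat \<Rightarrow> nat"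
  have [measurable]: "(\<lambda>\<omega>. of_bool ((X j \<omega> = i) = b) :: real) \<in> borel_measurable M" if "j \<ge> 1" for j b
    using X_eq_measurable[OF that] by measurable
  have "indep_var borel (?h \<circ> ?TT) borel (?f \<circ> ?XX)"
    using T_X_indep
  proof (rule indep_var_comp_of_indep_set)
    show "?TT \<in> measurable M (PiM {1..} (\<lambda>_. borel))"
      using T_measurable by (intro measurable_restrict) auto
    show "?XX \<in> measurable M (PiM {1..} (\<lambda>_. count_space {0, 1}))"
      using X_measurable by (intro measurable_restrict) auto
    show "?h \<in> borel_measurable (PiM {1..} (\<lambda>_. borel))" by measurable
    show "?f \<in> borel_measurable (PiM {1..} (\<lambda>_. count_space {0, 1::nat}))"
    proof (rule borel_measurable_prod)
      fix j assume "j \<in> ?J"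
      then have "(\<lambda>x. x j) \<in> measurable (PiM {1..} (\<lambda>_. count_space {0, 1::nat})) (count_space {0, 1})"
        by (intro measurable_component_singleton) auto
      then show "(\<lambda>x. of_bool ((x j = i) = (j = Suc k)) :: real) \<in>
          borel_measurable (PiM {1..} (\<lambda>_. count_space {0, 1::nat}))"
        by (rule measurable_compose) auto
    qed
  qed
  moreover have "?h \<circ> ?TT = (\<lambda>\<omega>. ?h (\<lambda>j. T j \<omega>))"
    by (auto simp: fun_eq_iff intro!: prod.cong)
  moreover have "?f \<circ> ?XX = (\<lambda>\<omega>. first_at X i k \<omega>)"
    by (auto simp: fun_eq_iff first_at_def intro!: prod.cong)
  ultimately have indep: "indep_var borel (\<lambda>\<omega>. ?h (\<lambda>j. T j \<omega>)) borel (\<lambda>\<omega>. first_at X i k \<omega>)"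
    by simp
  have intT: "integrable M (\<lambda>\<omega>. lap (T j \<omega>) ^ a)" if "j \<ge> 1" for j a
    using T_measurable[OF that] by (intro integrable_const_bound[where B=1]) auto
  have intX: "integrable M (\<lambda>\<omega>. of_bool ((X j \<omega> = i) = b) :: real)" if "j \<ge> 1" for j b
    using that by (intro integrable_const_bound[where B=1]) auto
  have iT: "indep_vars (\<lambda>_. borel) (\<lambda>j \<omega>. lap (T j \<omega>) ^ (if j = 1 then l else n)) ?J"
    by (rule indep_vars_compose2[OF indep_vars_subset[OF T_indep]]) auto
  have iX: "indep_vars (\<lambda>_. borel) (\<lambda>j \<omega>. of_bool ((X j \<omega> = i) = (j = Suc k)) :: real) ?J"
    by (rule indep_vars_compose2[OF indep_vars_subset[OF X_indep]]) auto
  note T_prod = indep_vars_lebesgue_integral[OF _ iT] indep_vars_integrable[OF _ iT]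
  note X_prod = indep_vars_lebesgue_integral[OF _ iX] indep_vars_integrable[OF _ iX]
  have "expectation (\<lambda>\<omega>. first_at X i k \<omega> * ?h (\<lambda>j. T j \<omega>)) =
      expectation (\<lambda>\<omega>. ?h (\<lambda>j. T j \<omega>) * first_at X i k \<omega>)"
    by (simp add: mult.commute)
  also have "\<dots> = expectation (\<lambda>\<omega>. ?h (\<lambda>j. T j \<omega>)) * expectation (\<lambda>\<omega>. first_at X i k \<omega>)"
    by (rule indep_var_lebesgue_integral[OF indep])
      (use T_prod(2) X_prod(2) intT intX in \<open>auto simp: first_at_def\<close>)
  also have "expectation (\<lambda>\<omega>. first_at X i k \<omega>) = (\<Prod>j\<in>?J. expectation (\<lambda>\<omega>. of_bool ((X j \<omega> = i) = (j = Suc k))))"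
    unfolding first_at_def by (rule X_prod(1)) (use intX in auto)
  also have "\<dots> = (\<Prod>j\<in>?J. if j = Suc k then type_prob i else 1 - type_prob i)"
    using assms by (intro prod.cong refl expectation_X_eq) auto
  also have "\<dots> = (1 - type_prob i) ^ k * type_prob i"
    by simp
  also have "expectation (\<lambda>\<omega>. ?h (\<lambda>j. T j \<omega>)) =
      (\<Prod>j\<in>?J. expectation (\<lambda>\<omega>. lap (T j \<omega>) ^ (if j = 1 then l else n)))"
    by (rule T_prod(1)) (use intT in auto)
  also have "\<dots> = (\<Prod>j\<in>?J. lap_moment (distr M borel (T j)) (if j = 1 then l else n))"
    by (intro prod.cong refl) (simp add: lap_moment_def integral_distr)
  also have "\<dots> = lap_moment (distr M borel (T 1)) l * (\<Prod>j\<in>{2..Suc k}. lap_moment (distr M borel (T j)) (if j = 1 then l else n))"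
    by (subst prod.atLeast_Suc_atMost) (simp_all add: numeral_2_eq_2)
  also have "(\<Prod>j\<in>{2..Suc k}. lap_moment (distr M borel (T j)) (if j = 1 then l else n)) =
      (\<Prod>j\<in>{2..Suc k}. lap_moment (distr M borel (T 2)) n)"
  proof (intro prod.cong refl)
    fix j assume "j \<in> {2..Suc k}"
    then show "lap_moment (distr M borel (T j)) (if j = 1 then l else n) = lap_moment (distr M borel (T 2)) n"
      using T_law[of j] by simp
  qed
  also have "\<dots> = lap_moment (distr M borel (T 2)) n ^ k"
    by simp
  finally show ?thesis by (simp only: mult_ac)
qed

end

context two_type_arrivals
begin

abbreviation "\<phi> \<equiv> lap_moment (distr M borel (T 1))"
abbreviation "\<psi> \<equiv> lap_moment (distr M borel (T 2))"

lemma prob_space_T: "prob_space (distr M borel (T 1))" "prob_space (distr M borel (T 2))"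
  by (auto intro!: prob_space_distr)

lemma first_at_measurable [measurable]: "first_at X i k \<in> borel_measurable M"
  unfolding first_at_def
proof (rule borel_measurable_prod)
  fix j assume "j \<in> {1..Suc k}"
  then have [measurable]: "Measurable.pred M (\<lambda>\<omega>. X j \<omega> = i)"
    by (intro X_eq_measurable) auto
  show "(\<lambda>\<omega>. of_bool ((X j \<omega> = i) = (j = Suc k)) :: real) \<in> borel_measurable M"
    by measurable
qed

lemma lap_prod_measurable [measurable]: "(\<lambda>\<omega>. \<Prod>j=1..k. lap (T j \<omega>) ^ a j) \<in> borel_measurable M"
  by (intro borel_measurable_prod borel_measurable_power measurable_compose[OF T_measurable lap_measurable]) auto

text \<open>Instead of treating the infimum directly, \<open>lap\<close> of the first arrival is
  written as a pointwise series of measurable functions and \<open>unlap\<close> is applied.\<close>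

lemma first_arrival_measurable [measurable]: "first_arrival T X i \<in> borel_measurable M"
proof -
  have "(\<lambda>\<omega>. \<Sum>k. first_at X i k \<omega> * (\<Prod>j=1..Suc k. lap (T j \<omega>) ^ 1)) \<in> borel_measurable M"
    by measurable
  also have "(\<lambda>\<omega>. \<Sum>k. first_at X i k \<omega> * (\<Prod>j=1..Suc k. lap (T j \<omega>) ^ 1)) =
      (\<lambda>\<omega>. lap (first_arrival T X i \<omega>))"
    using first_at_sums_lap_first_arrival[of 1 X i _ T] by (simp add: sums_iff fun_eq_iff)
  finally have "(\<lambda>\<omega>. unlap (lap (first_arrival T X i \<omega>))) \<in> borel_measurable M"
    by measurable
  then show ?thesis by simp
qed

lemma type_prob_psi_bounds: "0 \<le> (1 - type_prob i) * \<psi> n" "(1 - type_prob i) * \<psi> n < 1"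
proof -
  have \<psi>: "0 \<le> \<psi> n" "\<psi> n \<le> 1"
    using lap_moment_nonneg[OF prob_space_T(2)] lap_moment_le_1[OF prob_space_T(2)] by simp_all
  then show "0 \<le> (1 - type_prob i) * \<psi> n"
    using type_prob_bounds[of i] by simp
  have "(1 - type_prob i) * \<psi> n \<le> (1 - type_prob i) * 1"
    using \<psi> type_prob_bounds[of i] by (intro mult_left_mono) auto
  also have "\<dots> < 1"
    using type_prob_bounds[of i] by simp
  finally show "(1 - type_prob i) * \<psi> n < 1" .
qed

text \<open>Summing over the index of the first point of type i gives a geometric series of ratio
  \<open>(1 - type_prob i) * \<psi> n\<close>, in which \<open>T 1\<close> carries the total
  exponent m + n. The case m = 0 is the marginal moment; general m is needed for the joint
  one.\<close>

lemma expectation_lap_first_arrival: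
  assumes "n \<ge> 1" and i: "i \<in> {0, 1}"
  shows "expectation (\<lambda>\<omega>. lap (T 1 \<omega>) ^ m * lap (first_arrival T X i \<omega>) ^ n) =
    type_prob i * \<phi> (m + n) / (1 - (1 - type_prob i) * \<psi> n)"
proof -
  define a where "a j = (if j = 1 then m + n else n)" for j :: nat
  define f where "f k \<omega> = first_at X i k \<omega> * (\<Prod>j=1..Suc k. lap (T j \<omega>) ^ a j)" for k \<omega>
  have prod_eq: "(\<Prod>j=1..Suc k. lap (T j \<omega>) ^ a j) = lap (T 1 \<omega>) ^ m * (\<Prod>j=1..Suc k. lap (T j \<omega>)) ^ n" for k \<omega>
  proof -
    have "(\<Prod>j=1..Suc k. lap (T j \<omega>) ^ a j) = lap (T 1 \<omega>) ^ (m + n) * (\<Prod>j=Suc 1..Suc k. lap (T j \<omega>) ^ a j)"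
      by (subst prod.atLeast_Suc_atMost) (simp_all add: a_def)
    also have "(\<Prod>j=Suc 1..Suc k. lap (T j \<omega>) ^ a j) = (\<Prod>j=Suc 1..Suc k. lap (T j \<omega>)) ^ n"
      unfolding prod_power_distrib by (intro prod.cong) (auto simp: a_def)
    also have "lap (T 1 \<omega>) ^ (m + n) * (\<Prod>j=Suc 1..Suc k. lap (T j \<omega>)) ^ n =
        lap (T 1 \<omega>) ^ m * (lap (T 1 \<omega>) * (\<Prod>j=Suc 1..Suc k. lap (T j \<omega>))) ^ n"
      by (simp only: power_add power_mult_distrib mult.assoc)
    also have "lap (T 1 \<omega>) * (\<Prod>j=Suc 1..Suc k. lap (T j \<omega>)) = (\<Prod>j=1..Suc k. lap (T j \<omega>))"
      by (subst (2) prod.atLeast_Suc_atMost) simp_all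
    finally show ?thesis .
  qed
  have f_sums: "(\<lambda>k. f k \<omega>) sums (lap (T 1 \<omega>) ^ m * lap (first_arrival T X i \<omega>) ^ n)" for \<omega>
    using sums_mult[OF first_at_sums_lap_first_arrival[OF assms(1), of X i \<omega> T], of "lap (T 1 \<omega>) ^ m"]
    unfolding f_def prod_eq by (simp only: mult_ac)
  have f_nonneg: "0 \<le> f k \<omega>" for k \<omega>
    by (auto simp: f_def first_at_def intro!: mult_nonneg_nonneg prod_nonneg)
  have f_le: "f k \<omega> \<le> 1" for k \<omega>
    unfolding f_def first_at_def by (intro mult_le_one prod_le_1 prod_nonneg) auto
  have f_meas [measurable]: "f k \<in> borel_measurable M" for k
    unfolding f_def by measurable
  have f_int: "integrable M (f k)" for k
    using f_nonneg f_le by (intro integrable_const_bound[where B=1]) auto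
  let ?x = "(1 - type_prob i) * \<psi> n"
  have f_exp: "expectation (f k) = type_prob i * \<phi> (m + n) * ?x ^ k" for k
    unfolding f_def a_def using expectation_first_at[OF i, of k "m + n" n]
    by (simp only: power_mult_distrib mult_ac)
  have geo: "(\<lambda>k. type_prob i * \<phi> (m + n) * ?x ^ k) sums (type_prob i * \<phi> (m + n) * (1 / (1 - ?x)))"
    using type_prob_psi_bounds[of i n] by (intro sums_mult geometric_sums) auto
  have "(\<lambda>k. expectation (f k)) sums expectation (\<lambda>\<omega>. \<Sum>k. f k \<omega>)"
  proof (rule sums_integral[OF f_int])
    show "AE \<omega> in M. summable (\<lambda>k. norm (f k \<omega>))"
      using f_sums f_nonneg by (simp add: sums_iff)
    show "summable (\<lambda>k. expectation (\<lambda>\<omega>. norm (f k \<omega>)))"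
      using geo f_nonneg f_exp by (simp add: sums_iff)
  qed
  then have "(\<lambda>k. type_prob i * \<phi> (m + n) * ?x ^ k) sums
      expectation (\<lambda>\<omega>. lap (T 1 \<omega>) ^ m * lap (first_arrival T X i \<omega>) ^ n)"
    unfolding f_exp using f_sums by (simp add: sums_iff)
  from sums_unique2[OF this geo] show ?thesis by simp
qed

text \<open>One of the two first arrivals is \<open>T\<^sub>1\<close>, so that exactly one of the two summands on the left
  equals \<open>lap T\<^sub>1 ^ (m + n)\<close>.\<close>

lemma lap_first_arrivals_eq:
  assumes "\<omega> \<in> space M"
  shows "lap (T 1 \<omega>) ^ m * lap (first_arrival T X 0 \<omega>) ^ n + lap (T 1 \<omega>) ^ n * lap (first_arrival T X 1 \<omega>) ^ m =
    lap (first_arrival T X 1 \<omega>) ^ m * lap (first_arrival T X 0 \<omega>) ^ n + lap (T 1 \<omega>) ^ (m + n)"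
proof -
  have "first_arrival T X (X 1 \<omega>) \<omega> = T 1 \<omega>"
    using first_arrival_eq_arrival_time[of X 0 \<omega> "X 1 \<omega>" T] by (simp add: arrival_time_def)
  then show ?thesis
    using X_range[of 1 \<omega>] assms by (auto simp: power_add algebra_simps)
qed

text \<open>Expectations in \<open>lap_first_arrivals_eq\<close> express the joint moment through
  three known ones, with no conditioning on \<open>X 1\<close>. The joint moment and the product of
  the marginals then share the positive factor p (1 - p) / (A B), which cancels.\<close>

lemma indep_first_arrivals_iff:
  "indep_var borel (first_arrival T X 1) borel (first_arrival T X 0) \<longleftrightarrow> transform_eq \<phi> \<psi>"
proof -
  have int: "integrable M (\<lambda>\<omega>. lap (U \<omega>) ^ m * lap (V \<omega>) ^ n)"
    if [measurable]: "U \<in> borel_measurable M" "V \<in> borel_measurable M" for U V m n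
    by (rule integrable_const_bound[where B=1]) (auto intro!: mult_le_one)
  have "(expectation (\<lambda>\<omega>. lap (first_arrival T X 1 \<omega>) ^ m * lap (first_arrival T X 0 \<omega>) ^ n) =
      expectation (\<lambda>\<omega>. lap (first_arrival T X 1 \<omega>) ^ m) * expectation (\<lambda>\<omega>. lap (first_arrival T X 0 \<omega>) ^ n)) \<longleftrightarrow>
    \<phi> (m + n) * (1 - (1 - \<psi> m) * (1 - \<psi> n)) = \<phi> m * \<phi> n" if mn: "m \<ge> 1" "n \<ge> 1" for m n
  proof -
    have T_int: "expectation (\<lambda>\<omega>. lap (T 1 \<omega>) ^ (m + n)) = \<phi> (m + n)"
      by (simp add: lap_moment_def integral_distr)
    have "expectation (\<lambda>\<omega>. lap (T 1 \<omega>) ^ m * lap (first_arrival T X 0 \<omega>) ^ n + lap (T 1 \<omega>) ^ n * lap (first_arrival T X 1 \<omega>) ^ m) =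
        expectation (\<lambda>\<omega>. lap (first_arrival T X 1 \<omega>) ^ m * lap (first_arrival T X 0 \<omega>) ^ n + lap (T 1 \<omega>) ^ (m + n))"
      by (intro Bochner_Integration.integral_cong refl lap_first_arrivals_eq)
    then have joint: "expectation (\<lambda>\<omega>. lap (first_arrival T X 1 \<omega>) ^ m * lap (first_arrival T X 0 \<omega>) ^ n) =
        (1 - p) * \<phi> (m + n) / (1 - p * \<psi> n) + p * \<phi> (m + n) / (1 - (1 - p) * \<psi> m) - \<phi> (m + n)"
      using expectation_lap_first_arrival[OF mn(2), of 0 m] expectation_lap_first_arrival[OF mn(1), of 1 n]
        int[of "T 1" "first_arrival T X 0" m n] int[of "T 1" "first_arrival T X 1" n m]
        int[of "first_arrival T X 1" "first_arrival T X 0" m n] int[of "T 1" "T 1" "m" "n"] T_int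
      by (simp add: type_prob_def add.commute power_add[symmetric])
    have marg: "expectation (\<lambda>\<omega>. lap (first_arrival T X 1 \<omega>) ^ m) = p * \<phi> m / (1 - (1 - p) * \<psi> m)"
      "expectation (\<lambda>\<omega>. lap (first_arrival T X 0 \<omega>) ^ n) = (1 - p) * \<phi> n / (1 - p * \<psi> n)"
      using expectation_lap_first_arrival[OF mn(1), of 1 0] expectation_lap_first_arrival[OF mn(2), of 0 0]
      by (simp_all add: type_prob_def)
    define A B where "A = 1 - (1 - p) * \<psi> m" and "B = 1 - p * \<psi> n"
    have AB: "A > 0" "B > 0"
      using type_prob_psi_bounds(2)[of 1 m] type_prob_psi_bounds(2)[of 0 n]
      by (simp_all add: A_def B_def type_prob_def)
    have "(1 - p) * \<phi> (m + n) / B + p * \<phi> (m + n) / A - \<phi> (m + n) =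
        \<phi> (m + n) * ((1 - p) * A + p * B - A * B) / (A * B)"
      using AB by (simp add: field_simps)
    \<comment> \<open>The identity behind the disappearance of p: the remaining bracket contains
      only \<open>\<psi>\<close>.\<close>
    also have "(1 - p) * A + p * B - A * B = p * (1 - p) * (1 - (1 - \<psi> m) * (1 - \<psi> n))"
      by (simp add: A_def B_def algebra_simps)
    finally have joint': "(1 - p) * \<phi> (m + n) / B + p * \<phi> (m + n) / A - \<phi> (m + n) =
        p * (1 - p) * (\<phi> (m + n) * (1 - (1 - \<psi> m) * (1 - \<psi> n))) / (A * B)"
      by (simp add: mult_ac)
    have prod': "p * \<phi> m / A * ((1 - p) * \<phi> n / B) = p * (1 - p) * (\<phi> m * \<phi> n) / (A * B)"
      by (simp add: mult_ac)
    show ?thesis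
      unfolding joint marg A_def[symmetric] B_def[symmetric] joint' prod' using AB p by simp
  qed
  then show ?thesis
    by (simp add: indep_var_iff_lap_moments transform_eq_def)
qed

lemma clause_iff:
  "clause_holds M T Clause_a \<longleftrightarrow> \<phi> 1 = 0"
  "clause_holds M T Clause_b \<longleftrightarrow>
    (\<exists>C. 0 < C \<and> C \<le> 1 \<and> (\<forall>n\<ge>1. \<phi> n = C ^ n) \<and> (\<forall>n\<ge>1. \<psi> n = 1))"
  "clause_holds M T Clause_c \<longleftrightarrow>
    (\<exists>C. 0 < C \<and> C \<le> 1 \<and> (\<exists>q. 0 < q \<and> q < 1 \<and>
      (\<forall>n\<ge>1. \<phi> n = C ^ n * (1 - q\<^sup>2)) \<and> (\<forall>n\<ge>1. \<psi> n = 1 - q)))"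
  "clause_holds M T Clause_d \<longleftrightarrow>
    (\<exists>C. 0 < C \<and> C \<le> 1 \<and> (\<exists>\<theta>>0.
      (\<forall>n\<ge>1. \<phi> n = C ^ n * (\<theta> / (\<theta> + real n))) \<and> (\<forall>n\<ge>1. \<psi> n = \<theta> / (\<theta> + real n))))"
  "clause_holds M T Clause_e \<longleftrightarrow>
    (\<exists>q. 0 < q \<and> q < 1 \<and> (\<exists>C. 0 < C \<and> C \<le> 1 \<and> (\<exists>z. 0 < z \<and> z < 1 \<and>
      (\<forall>n\<ge>1. \<phi> n = C ^ n * ((1 - q\<^sup>2) / (1 - q\<^sup>2 * z ^ n))) \<and>
      (\<forall>n\<ge>1. \<psi> n = (1 - q) + q * ((1 - q\<^sup>2) * z ^ n / (1 - q\<^sup>2 * z ^ n))))))"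
  by (intro clause_a_iff clause_b_iff clause_c_iff clause_d_iff clause_e_iff prob_space_axioms T_measurable; simp)+

section \<open>The clauses as the solution set, and their mutual exclusion\<close>

lemma transform_eq_iff_ex_clause: "transform_eq \<phi> \<psi> \<longleftrightarrow> (\<exists>c. clause_holds M T c)"
proof
  assume eq: "transform_eq \<phi> \<psi>"
  show "\<exists>c. clause_holds M T c"
  proof (cases "\<phi> 1 = 0")
    case True
    then show ?thesis using clause_iff(1) by blast
  next
    case False
    note \<phi> = lap_moment_nonneg[OF prob_space_T(1) sets_distr] lap_moment_Suc_le[OF prob_space_T(1) sets_distr]
    note \<psi> = lap_moment_nonneg[OF prob_space_T(2) sets_distr] lap_moment_le_1[OF prob_space_T(2) sets_distr]
      lap_moment_Suc_le[OF prob_space_T(2) sets_distr] lap_moment_bernoulli[OF prob_space_T(2) sets_distr]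
    show ?thesis
      using eq False \<phi> \<psi>
    proof (cases rule: transform_eq_solutions)
      case deterministic
      then show ?thesis using clause_iff(2) by blast
    next
      case two_point
      then show ?thesis using clause_iff(3) by blast
    next
      case exponential
      then show ?thesis using clause_iff(4) by blast
    next
      case geometric
      then show ?thesis using clause_iff(5) by blast
    qed
  qed
next
  assume "\<exists>c. clause_holds M T c"
  then obtain c where c: "clause_holds M T c" ..
  have scaled: "transform_eq \<phi> \<psi>"
    if "transform_eq B \<psi>'" "\<forall>n\<ge>1. \<phi> n = C ^ n * B n" "\<forall>n\<ge>1. \<psi> n = \<psi>' n" for B C \<psi>'
    using transform_eq_power_scale[of B \<psi>' \<phi> C] transform_eq_cong[of \<phi> \<phi> \<psi> \<psi>'] that by blast
  show "transform_eq \<phi> \<psi>"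
  proof (cases c)
    case Clause_a
    then have "\<phi> 1 = 0" using c clause_iff(1) by simp
    have "\<phi> n = 0" if "n \<ge> 1" for n
      using that
    proof (induction n rule: dec_induct)
      case base
      show ?case by fact
    next
      case (step n)
      then show ?case
        using lap_moment_Suc_le[OF prob_space_T(1) sets_distr, of n]
          lap_moment_nonneg[OF prob_space_T(1) sets_distr, of "Suc n"] by simp
    qed
    then show ?thesis
      using transform_eq_zero transform_eq_cong[of \<phi> "\<lambda>_. 0" \<psi> \<psi>] by blast
  next
    case Clause_b
    then show ?thesis using c clause_iff(2) scaled[OF transform_eq_one] by auto
  next
    case Clause_c
    then show ?thesis using c clause_iff(3) scaled[OF transform_eq_const] by blast
  next
    case Clause_d
    then show ?thesis using c clause_iff(4) scaled[OF transform_eq_exponential] by blast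
  next
    case Clause_e
    then show ?thesis using c clause_iff(5) scaled[OF transform_eq_geometric] less_imp_le by blast
  qed
qed

text \<open>The clauses are told apart successively by whether \<open>\<phi> 1\<close> vanishes (a),
  whether \<open>\<psi> 1\<close> is 1 (b), whether \<open>\<psi> 1\<close> and
  \<open>\<psi> 2\<close> agree (c), and whether \<open>\<psi>\<close> tends to 0 (d) or to 1 - q >
  0 (e). This last limit is the mass of \<open>T 2\<close> at 0.\<close>

lemma clause_unique:
  assumes "clause_holds M T c" "clause_holds M T c'"
  shows "c = c'"
proof -
  have q2: "1 - q\<^sup>2 > 0" if "0 < q" "q < 1" for q :: real
    using that by (simp add: abs_square_less_1)
  have a: "\<phi> 1 = 0" if "clause_holds M T Clause_a"
    using that by (simp only: clause_iff)
  have b: "\<phi> 1 \<noteq> 0 \<and> \<psi> 1 = 1" if "clause_holds M T Clause_b"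
    using that unfolding clause_iff by auto
  have c: "\<phi> 1 \<noteq> 0 \<and> \<psi> 1 \<noteq> 1 \<and> \<psi> 1 = \<psi> 2" if "clause_holds M T Clause_c"
    using that q2 unfolding clause_iff by force
  have d: "\<phi> 1 \<noteq> 0 \<and> \<psi> 1 \<noteq> 1 \<and> \<psi> 1 \<noteq> \<psi> 2 \<and> \<psi> \<longlonglongrightarrow> 0" if "clause_holds M T Clause_d"
  proof -
    from that obtain C \<theta> where C: "0 < C" "0 < \<theta>" "\<forall>n\<ge>1. \<phi> n = C ^ n * (\<theta> / (\<theta> + real n))"
      and \<psi>: "\<forall>n\<ge>1. \<psi> n = \<theta> / (\<theta> + real n)"
      unfolding clause_iff by blast
    have "filterlim (\<lambda>n. \<theta> + real n) at_top sequentially"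
      using C(2) by (intro filterlim_at_top_mono[OF filterlim_real_sequentially]) auto
    then have "(\<lambda>n. \<theta> / (\<theta> + real n)) \<longlonglongrightarrow> 0"
      by (intro tendsto_divide_0[OF tendsto_const] filterlim_at_top_imp_at_infinity)
    then have "\<psi> \<longlonglongrightarrow> 0"
      by (rule Lim_transform_eventually) (use \<psi> in \<open>auto simp: eventually_sequentially intro!: exI[of _ 1]\<close>)
    moreover have "\<psi> 1 = \<theta> / (\<theta> + 1)" "\<psi> 2 = \<theta> / (\<theta> + 2)" "\<phi> 1 = C * (\<theta> / (\<theta> + 1))"
      using C \<psi> by auto
    moreover have "\<theta> / (\<theta> + 1) \<noteq> 1" "\<theta> / (\<theta> + 1) \<noteq> \<theta> / (\<theta> + 2)"
      using C(2) by (simp_all add: field_simps)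
    ultimately show ?thesis using C(1,2) by simp
  qed
  have e: "\<phi> 1 \<noteq> 0 \<and> \<psi> 1 \<noteq> 1 \<and> \<psi> 1 \<noteq> \<psi> 2 \<and> \<not> \<psi> \<longlonglongrightarrow> 0" if "clause_holds M T Clause_e"
  proof -
    from that obtain C q z where C: "0 < C" and q: "0 < q" "q < 1" and z: "0 < z" "z < 1"
      and \<phi>: "\<forall>n\<ge>1. \<phi> n = C ^ n * ((1 - q\<^sup>2) / (1 - q\<^sup>2 * z ^ n))"
      and \<psi>: "\<forall>n\<ge>1. \<psi> n = (1 - q) + q * ((1 - q\<^sup>2) * z ^ n / (1 - q\<^sup>2 * z ^ n))"
      unfolding clause_iff by blast
    note P = one_minus_square_power_pos[OF q less_imp_le less_imp_le, OF z]
    have "(\<lambda>n. (1 - q) + q * ((1 - q\<^sup>2) * z ^ n / (1 - q\<^sup>2 * z ^ n))) \<longlonglongrightarrow>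
        (1 - q) + q * ((1 - q\<^sup>2) * 0 / (1 - q\<^sup>2 * 0))"
      using z by (intro tendsto_intros LIMSEQ_realpow_zero) auto
    then have "\<psi> \<longlonglongrightarrow> 1 - q"
      by (intro Lim_transform_eventually[of _ "1 - q" sequentially \<psi>])
        (use \<psi> in \<open>auto simp: eventually_sequentially intro!: exI[of _ 1]\<close>)
    then have "\<not> \<psi> \<longlonglongrightarrow> 0" using q LIMSEQ_unique by fastforce
    moreover have \<psi>12: "\<psi> 1 = 1 - q * (1 - z) / (1 - q\<^sup>2 * z)" "\<psi> 2 = 1 - q * (1 - z\<^sup>2) / (1 - q\<^sup>2 * z\<^sup>2)"
      using \<psi> geometric_transform_alt[OF q less_imp_le less_imp_le, OF z, of 1]
        geometric_transform_alt[OF q less_imp_le less_imp_le, OF z, of 2] by simp_all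
    moreover have "\<phi> 1 \<noteq> 0" using \<phi> C q2[OF q] P[of 1] by simp
    moreover have "\<psi> 1 \<noteq> 1" unfolding \<psi>12 using q z P[of 1] by simp
    moreover have "\<psi> 1 \<noteq> \<psi> 2"
    proof
      assume "\<psi> 1 = \<psi> 2"
      then have "q * ((1 - z) * (1 - q\<^sup>2 * z\<^sup>2)) = q * ((1 - z\<^sup>2) * (1 - q\<^sup>2 * z))"
        unfolding \<psi>12 using P[of 1] P[of 2] by (simp add: field_simps)
      then have "(1 - z) * (1 - q\<^sup>2 * z\<^sup>2) = (1 - z\<^sup>2) * (1 - q\<^sup>2 * z)"
        using q by simp
      \<comment> \<open>The right side minus the left side of the preceding equation factors in this
        way.\<close>
      then have "z * (1 - z) * (1 - q\<^sup>2) = 0"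
        by (simp add: algebra_simps power2_eq_square)
      then show False using z q2[OF q] by simp
    qed
    ultimately show ?thesis by blast
  qed
  show ?thesis
    using assms a b c d e by (cases c; cases c') auto
qed

end

theorem proposition3:
  fixes M :: "'a measure" and p :: real
    and T :: "nat \<Rightarrow> 'a \<Rightarrow> ennreal" and X :: "nat \<Rightarrow> 'a \<Rightarrow> nat"
  assumes "prob_space M"
    and "0 < p" and "p < 1"
    and "prob_space.indep_vars M (\<lambda>_. borel) T {1..}"
    and "\<And>j. j \<ge> 2 \<Longrightarrow> distr M borel (T j) = distr M borel (T 2)"
    and "prob_space.indep_vars M (\<lambda>_. count_space {0, 1}) X {1..}"
    and "\<And>i. i \<ge> 1 \<Longrightarrow> distr M (count_space {0, 1}) (X i) = distr M (count_space {0, 1}) (X 1)"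
    and "measure M {\<omega> \<in> space M. X 1 \<omega> = 1} = p"
    and "measure M {\<omega> \<in> space M. X 1 \<omega> = 0} = 1 - p"
    and "prob_space.indep_set M
           (sets (vimage_algebra (space M) (\<lambda>\<omega>. \<lambda>i\<in>{1..}. T i \<omega>) (PiM {1..} (\<lambda>_. borel))))
           (sets (vimage_algebra (space M) (\<lambda>\<omega>. \<lambda>i\<in>{1..}. X i \<omega>)
              (PiM {1..} (\<lambda>_. count_space {0, 1}))))"
  shows "(prob_space.indep_var M borel (first_arrival T X 1) borel (first_arrival T X 0)
            \<longleftrightarrow> (\<exists>c. clause_holds M T c)) \<and>
         (prob_space.indep_var M borel (first_arrival T X 1) borel (first_arrival T X 0)
            \<longleftrightarrow> (\<exists>!c. clause_holds M T c))"
proof -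
  interpret two_type_arrivals M p T X
    unfolding two_type_arrivals_def two_type_arrivals_axioms_def using assms by blast
  show ?thesis
    \<comment> \<open>As two different clauses never hold together, existence of a clause and unique
      existence coincide, which settles both readings of the equivalence.\<close>
    unfolding indep_first_arrivals_iff transform_eq_iff_ex_clause using clause_unique by blast
qed

end
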